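(* The image of $B_n$ under the integral Burau representation $\rho\colon B_n\to\Gamma_{n-1}\le\mathrm{GL}_n(\mathbb{Z})$ is, under the identification of $\Gamma_1$ with $[\mathrm{Sp}_2(\mathbb{Z})]_{e_1}$ and of $\Gamma_2$ with $\mathrm{Sp}_2(\mathbb{Z})$, (1) for $n=2$: $[\mathrm{SL}_2(\mathbb{Z})]_{e_1}=[\mathrm{Sp}_2(\mathbb{Z})]_{e_1}\cong\mathbb{Z}$ (that is, all of $\Gamma_1$); (2) for $n=3$: $\mathrm{SL}_2(\mathbb{Z})=\mathrm{Sp}_2(\mathbb{Z})$ (that is, all of $\Gamma_2$); (3) for $n\ge4$: the preimage of $S_n\le\Gamma_{n-1}/\Gamma_{n-1}[2]$ along the quotient map $\Gamma_{n-1}\to\Gamma_{n-1}/\Gamma_{n-1}[2]$.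
   Context: $B_n$ is the braid group on $n$ strands with Artin generators $\sigma_1,\dots,\sigma_{n-1}$. The integral Burau representation $\rho\colon B_n\to \mathrm{GL}_n(\mathbb{Z})$ is the unreduced Burau representation at $t=-1$: $\rho(\sigma_i)$ is the block diagonal matrix with blocks $I_{i-1}$, $\begin{pmatrix}2&-1\\1&0\end{pmatrix}$, $I_{n-i-1}$. For $\ell\ge1$, $B_n[\ell]=\{b\in B_n\mid \rho(b)\equiv I_n \bmod \ell\}$. Equip $\mathbb{Z}^n$ (standard basis $e_1,\dots,e_n$) with the alternating bilinear form $\langle e_i,e_j\rangle=(-1)^{i+j+1}$ for $i<j$, $0$ for $i=j$, $(-1)^{i+j}$ for $i>j$. Let $v_n=e_1+\dots+e_n$ and $w_n=e_1-e_2+\dots+(-1)^{n-1}e_n$. Define \[\Gamma_{n-1}=\{A\in \mathrm{GL}_n(\mathbb{Z})\mid \langle Av,Aw\rangle=\langle v,w\rangle\ \forall v,w\in\mathbb{Z}^n,\ Av_n=v_n,\ w_n^TA=w_n^T\},\] \[\Gamma_{n-1}[\ell]=\{A\in\Gamma_{n-1}\mid A\equiv I_n \bmod \ell\}.\] The image of $\rho$ lies in $\Gamma_{n-1}$. Identifications: for $n=2$, the form on $\mathbb{Z}^2$ is unimodular and $\Gamma_1$ is the stabilizer of the unimodular vector $v_2$ in its symplectic group, so a change of basis identifies it with the stabilizer $[\mathrm{Sp}_2(\mathbb{Z})]_{e_1}$ of $e_1$. For $n=3$, $\mathbb{Z}^3=W\oplus\mathbb{Z}v_3$ with $W=\ker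 w_3^T$ a unimodular symplectic plane, and restriction to $W$ identifies $\Gamma_2$ with $\mathrm{Sp}_2(\mathbb{Z})$. For $n\ge4$, the inclusion $S_n\le\Gamma_{n-1}/\Gamma_{n-1}[2]$ is the one whose image is the image of $B_n$ in $\Gamma_{n-1}/\Gamma_{n-1}[2]$ under $\rho$; by Arnol'd, $B_n[2]$ is the pure braid group, so this image is $B_n/B_n[2]\cong S_n$. *)

theory Defs
  imports
    "Jordan_Normal_Form.Determinant"
    "HOL-Algebra.Sym_Groups"
    "HOL-Algebra.Elementary_Groups"
    "HOL-Number_Theory.Cong"
begin

text \<open>
  All indices are 0-based: strands, coordinates and Artin generators that are usually numbered
  from 1 are shifted down by one.  The only exceptions are the standard basis vectors
  \<open>e\<^sub>1, e\<^sub>2, \<dots>\<close> in informal text, and \<^const>\<open>sym_group\<close>, which acts on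
  \<^term>\<open>{1..n::nat}\<close>.
\<close>

section \<open>The braid group\<close>

text \<open>
  A letter \<^term>\<open>(i, e)\<close> stands for the Artin generator \<open>\<sigma>\<^sub>i\<close> if \<^term>\<open>e\<close> holds, and
  for its inverse otherwise.
\<close>

type_synonym braid_word = "(nat \<times> bool) list"

definition braid_words :: "nat \<Rightarrow> braid_word set" where
  "braid_words n = lists ({..<n - 1} \<times> UNIV)"

inductive braid_eq :: "nat \<Rightarrow> braid_word \<Rightarrow> braid_word \<Rightarrow> bool" for n :: nat where
  eq_refl: "w \<in> braid_words n \<Longrightarrow> braid_eq n w w"
| eq_sym: "braid_eq n u v \<Longrightarrow> braid_eq n v u"
| eq_trans: "braid_eq n u v \<Longrightarrow> braid_eq n v w \<Longrightarrow> braid_eq n u w"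
| eq_context: "braid_eq n u v \<Longrightarrow> x \<in> braid_words n \<Longrightarrow> y \<in> braid_words n
    \<Longrightarrow> braid_eq n (x @ u @ y) (x @ v @ y)"
| free_cancel: "i < n - 1 \<Longrightarrow> braid_eq n [(i, e), (i, \<not> e)] []"
| far_commute: "i < n - 1 \<Longrightarrow> j < n - 1 \<Longrightarrow> i + 2 \<le> j
    \<Longrightarrow> braid_eq n [(i, True), (j, True)] [(j, True), (i, True)]"
| braid_move: "i + 1 < n - 1
    \<Longrightarrow> braid_eq n [(i, True), (i + 1, True), (i, True)] [(i + 1, True), (i, True), (i + 1, True)]"

definition braid_rel :: "nat \<Rightarrow> (braid_word \<times> braid_word) set" where
  "braid_rel n = {(u, v). braid_eq n u v}"

definition braid_group :: "nat \<Rightarrow> braid_word set monoid" where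
  "braid_group n =
     \<lparr>carrier = braid_words n // braid_rel n,
      mult = (\<lambda>X Y. \<Union>u\<in>X. \<Union>v\<in>Y. braid_rel n `` {u @ v}),
      one = braid_rel n `` {[]}\<rparr>"

definition artin_gen :: "nat \<Rightarrow> nat \<Rightarrow> braid_word set" where
  "artin_gen n i = braid_rel n `` {[(i, True)]}"


lemma braid_words_simps [simp]:
  "[] \<in> braid_words n"
  "l # w \<in> braid_words n \<longleftrightarrow> fst l < n - 1 \<and> w \<in> braid_words n"
  "u @ w \<in> braid_words n \<longleftrightarrow> u \<in> braid_words n \<and> w \<in> braid_words n"
  by (auto simp: braid_words_def mem_Times_iff)

lemma braid_eq_words: "braid_eq n u v \<Longrightarrow> u \<in> braid_words n \<and> v \<in> braid_words n"
  by (induction rule: braid_eq.induct) auto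

lemma equiv_braid_rel: "equiv (braid_words n) (braid_rel n)"
proof (rule equivI)
  show "braid_rel n \<subseteq> braid_words n \<times> braid_words n"
    using braid_eq_words by (auto simp: braid_rel_def)
  show "refl_on (braid_words n) (braid_rel n)"
    by (intro refl_onI) (simp add: braid_rel_def braid_eq.eq_refl)
  show "Relation.sym (braid_rel n)"
    by (intro symI) (simp add: braid_rel_def braid_eq.eq_sym)
  show "Relation.trans (braid_rel n)"
    by (intro transI) (simp add: braid_rel_def, rule braid_eq.eq_trans)
qed

lemma braid_eq_append:
  assumes "braid_eq n u u'" "braid_eq n v v'"
  shows "braid_eq n (u @ v) (u' @ v')"
proof -
  have "braid_eq n ([] @ u @ v) ([] @ u' @ v)"
    using assms by (intro braid_eq.eq_context) (auto dest: braid_eq_words)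
  moreover have "braid_eq n (u' @ v @ []) (u' @ v' @ [])"
    using assms by (intro braid_eq.eq_context) (auto dest: braid_eq_words)
  ultimately show ?thesis using braid_eq.eq_trans by auto
qed

lemma braid_mult_class:
  assumes "u \<in> braid_words n" "v \<in> braid_words n"
  shows "(braid_rel n `` {u}) \<otimes>\<^bsub>braid_group n\<^esub> (braid_rel n `` {v}) = braid_rel n `` {u @ v}"
proof -
  have "braid_rel n `` {u' @ v'} = braid_rel n `` {u @ v}" if "braid_eq n u u'" "braid_eq n v v'" for u' v'
    using braid_eq_append[OF that] equiv_class_eq[OF equiv_braid_rel, of "u @ v" "u' @ v'" n]
    by (simp add: braid_rel_def)
  then have "(\<Union>u'\<in>braid_rel n `` {u}. \<Union>v'\<in>braid_rel n `` {v}. braid_rel n `` {u' @ v'})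
    = (\<Union>u'\<in>braid_rel n `` {u}. \<Union>v'\<in>braid_rel n `` {v}. braid_rel n `` {u @ v})"
    by (intro SUP_cong) (auto simp: braid_rel_def)
  moreover have "u \<in> braid_rel n `` {u}" "v \<in> braid_rel n `` {v}"
    using assms by (auto simp: braid_rel_def intro: braid_eq.eq_refl)
  ultimately show ?thesis
    by (auto simp: braid_group_def)
qed

lemma braid_carrierE:
  assumes "b \<in> carrier (braid_group n)"
  obtains w where "w \<in> braid_words n" "b = braid_rel n `` {w}"
  using assms by (auto simp: braid_group_def elim: quotientE)

lemma braid_class_carrier: "w \<in> braid_words n \<Longrightarrow> braid_rel n `` {w} \<in> carrier (braid_group n)"
  by (auto simp: braid_group_def intro: quotientI)

lemma braid_word_inverse:
  assumes "w \<in> braid_words n"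
  shows "\<exists>w' \<in> braid_words n. braid_eq n (w' @ w) []"
  using assms
proof (induction w)
  case Nil
  then show ?case by (intro bexI[of _ "[]"]) (auto intro: braid_eq.eq_refl)
next
  case (Cons l w)
  then obtain w' where w': "w' \<in> braid_words n" "braid_eq n (w' @ w) []" by auto
  obtain i e where l: "l = (i, e)" by (cases l)
  have "braid_eq n (w' @ [(i, \<not> e), (i, \<not> \<not> e)] @ w) (w' @ [] @ w)"
    using Cons.prems w' l by (intro braid_eq.eq_context braid_eq.free_cancel) auto
  then have "braid_eq n ((w' @ [(i, \<not> e)]) @ l # w) []"
    using w'(2) l braid_eq.eq_trans by auto
  then show ?case using Cons.prems w' l by (intro bexI[of _ "w' @ [(i, \<not> e)]"]) auto
qed

lemma group_braid_group: "group (braid_group n)"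
proof (rule groupI)
  have one: "\<one>\<^bsub>braid_group n\<^esub> = braid_rel n `` {[]}" by (simp add: braid_group_def)
  show "\<one>\<^bsub>braid_group n\<^esub> \<in> carrier (braid_group n)"
    using braid_class_carrier[of "[]" n] by (simp add: one)
  show "x \<otimes>\<^bsub>braid_group n\<^esub> y \<in> carrier (braid_group n)"
    if "x \<in> carrier (braid_group n)" "y \<in> carrier (braid_group n)" for x y
    using that by (auto elim!: braid_carrierE simp: braid_mult_class intro!: braid_class_carrier)
  show "x \<otimes>\<^bsub>braid_group n\<^esub> y \<otimes>\<^bsub>braid_group n\<^esub> z = x \<otimes>\<^bsub>braid_group n\<^esub> (y \<otimes>\<^bsub>braid_group n\<^esub> z)"
    if "x \<in> carrier (braid_group n)" "y \<in> carrier (braid_group n)" "z \<in> carrier (braid_group n)" for x y z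
    using that by (auto elim!: braid_carrierE simp: braid_mult_class)
  show "\<one>\<^bsub>braid_group n\<^esub> \<otimes>\<^bsub>braid_group n\<^esub> x = x" if "x \<in> carrier (braid_group n)" for x
    using that by (auto elim!: braid_carrierE simp: braid_mult_class one)
  show "\<exists>y\<in>carrier (braid_group n). y \<otimes>\<^bsub>braid_group n\<^esub> x = \<one>\<^bsub>braid_group n\<^esub>"
    if x: "x \<in> carrier (braid_group n)" for x
  proof -
    obtain w where w: "w \<in> braid_words n" "x = braid_rel n `` {w}" using x by (rule braid_carrierE)
    obtain w' where w': "w' \<in> braid_words n" "braid_eq n (w' @ w) []"
      using braid_word_inverse[OF w(1)] by auto
    have "braid_rel n `` {w' @ w} = braid_rel n `` {[]}"
      using w'(2) by (intro equiv_class_eq[OF equiv_braid_rel]) (simp add: braid_rel_def)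
    then show ?thesis
      using w w' by (intro bexI[of _ "braid_rel n `` {w'}"] braid_class_carrier)
        (auto simp: braid_mult_class one)
  qed
qed


section \<open>The integral Burau representation\<close>

definition GL_int :: "nat \<Rightarrow> int mat monoid" where
  "GL_int n = units_of (ring_mat TYPE(int) n ())"

definition burau_gen :: "nat \<Rightarrow> nat \<Rightarrow> int mat" where
  "burau_gen n i = mat n n (\<lambda>(r, c).
     if r = i \<and> c = i then 2
     else if r = i \<and> c = i + 1 then -1
     else if r = i + 1 \<and> c = i then 1
     else if r = i + 1 \<and> c = i + 1 then 0
     else if r = c then 1 else 0)"

definition burau_letter :: "nat \<Rightarrow> nat \<times> bool \<Rightarrow> int mat" where
  "burau_letter n = (\<lambda>(i, e). if e then burau_gen n i else inv\<^bsub>GL_int n\<^esub> (burau_gen n i))"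

definition burau_word :: "nat \<Rightarrow> braid_word \<Rightarrow> int mat" where
  "burau_word n w = foldr (\<lambda>l A. burau_letter n l * A) w (1\<^sub>m n)"

text \<open>
  Equivalent words have the same image under \<^const>\<open>burau_word\<close>, so the set below is a
  singleton for every braid; see \<open>burau_class\<close>.
\<close>

definition burau :: "nat \<Rightarrow> braid_word set \<Rightarrow> int mat" where
  "burau n b = the_elem (burau_word n ` b)"


lemma group_GL_int: "group (GL_int n)"
proof -
  interpret ring "ring_mat TYPE(int) n ()" by (rule ring_mat)
  show ?thesis unfolding GL_int_def by (rule units_group)
qed

lemma GL_int_simps [simp]:
  "A \<otimes>\<^bsub>GL_int n\<^esub> B = A * B" "\<one>\<^bsub>GL_int n\<^esub> = 1\<^sub>m n"
  by (simp_all add: GL_int_def units_of_mult units_of_one ring_mat_simps)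

lemma GL_int_iff:
  "A \<in> carrier (GL_int n) \<longleftrightarrow>
     A \<in> carrier_mat n n \<and> (\<exists>B \<in> carrier_mat n n. B * A = 1\<^sub>m n \<and> A * B = 1\<^sub>m n)"
  by (auto simp: GL_int_def units_of_carrier Units_def ring_mat_simps)

lemma GL_int_mat: "A \<in> carrier (GL_int n) \<Longrightarrow> A \<in> carrier_mat n n"
  by (simp add: GL_int_iff)

lemma mat_eq_by_action:
  assumes "A \<in> carrier_mat n n" "B \<in> carrier_mat n n"
    and "\<And>v::int vec. v \<in> carrier_vec n \<Longrightarrow> A *\<^sub>v v = B *\<^sub>v v"
  shows "A = B"
proof (rule eq_matI)
  fix i j assume ij: "i < dim_row B" "j < dim_col B"
  have "(A *\<^sub>v unit_vec n j) $ i = (B *\<^sub>v unit_vec n j) $ i" using assms(3) by simp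
  then show "A $$ (i, j) = B $$ (i, j)" using ij assms(1,2) by simp
qed (use assms in auto)

lemma burau_gen_mat [simp]: "burau_gen n i \<in> carrier_mat n n"
  by (simp add: burau_gen_def)

lemma burau_gen_action:
  assumes "i + 1 < n" "v \<in> carrier_vec n"
  shows "burau_gen n i *\<^sub>v v = vec n (\<lambda>r. v $ r + (if r = i \<or> r = i + 1 then v $ i - v $ (i + 1) else 0))"
proof (rule eq_vecI)
  fix r assume "r < dim_vec (vec n (\<lambda>r. v $ r + (if r = i \<or> r = i + 1 then v $ i - v $ (i + 1) else 0)))"
  then have r: "r < n" by simp
  have "(burau_gen n i *\<^sub>v v) $ r = (\<Sum>c<n. burau_gen n i $$ (r, c) * v $ c)"
    using r assms by (simp add: scalar_prod_def lessThan_atLeast0 burau_gen_def)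
  also have "\<dots> = (\<Sum>c<n. (if c = r then v $ c else 0)
      + (if c = i then (if r = i \<or> r = i + 1 then v $ c else 0) else 0)
      - (if c = i + 1 then (if r = i \<or> r = i + 1 then v $ c else 0) else 0))"
    using r assms by (intro sum.cong) (auto simp: burau_gen_def)
  also have "\<dots> = v $ r + (if r = i \<or> r = i + 1 then v $ i - v $ (i + 1) else 0)"
    using r assms(1) by (simp add: sum.distrib sum_subtractf)
  finally show "(burau_gen n i *\<^sub>v v) $ r = vec n (\<lambda>r. v $ r + (if r = i \<or> r = i + 1 then v $ i - v $ (i + 1) else 0)) $ r"
    using r by simp
qed (simp add: burau_gen_def)

lemma burau_gen_GL:
  assumes "i + 1 < n"
  shows "burau_gen n i \<in> carrier (GL_int n)"
proof -
  define B :: "int mat" where "B = (1\<^sub>m n + 1\<^sub>m n) - burau_gen n i"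
  have B: "B \<in> carrier_mat n n" unfolding B_def by (rule minus_carrier_mat) simp
  have act: "B *\<^sub>v v = vec n (\<lambda>r. v $ r - (if r = i \<or> r = i + 1 then v $ i - v $ (i + 1) else 0))"
    if v: "v \<in> carrier_vec n" for v
  proof -
    have "B *\<^sub>v v = (v + v) - burau_gen n i *\<^sub>v v"
      using v by (simp add: B_def minus_mult_distrib_mat_vec[of _ n n] add_mult_distrib_mat_vec[of _ n n])
    then show ?thesis using v assms by (intro eq_vecI) (auto simp: burau_gen_action)
  qed
  have "B * burau_gen n i = 1\<^sub>m n"
  proof (rule mat_eq_by_action)
    fix v :: "int vec" assume v: "v \<in> carrier_vec n"
    have "B * burau_gen n i *\<^sub>v v = B *\<^sub>v (burau_gen n i *\<^sub>v v)"
      using B v by (intro assoc_mult_mat_vec[of _ n n _ n]) auto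
    then show "B * burau_gen n i *\<^sub>v v = 1\<^sub>m n *\<^sub>v v"
      using v assms by (simp add: burau_gen_action act) (auto intro!: eq_vecI)
  qed (use B in \<open>auto intro: mult_carrier_mat[of _ n n _ n]\<close>)
  moreover have "burau_gen n i * B = 1\<^sub>m n"
  proof (rule mat_eq_by_action)
    fix v :: "int vec" assume v: "v \<in> carrier_vec n"
    have "burau_gen n i * B *\<^sub>v v = burau_gen n i *\<^sub>v (B *\<^sub>v v)"
      using B v by (intro assoc_mult_mat_vec[of _ n n _ n]) auto
    then show "burau_gen n i * B *\<^sub>v v = 1\<^sub>m n *\<^sub>v v"
      using v assms by (simp add: burau_gen_action act) (auto intro!: eq_vecI)
  qed (use B in \<open>auto intro: mult_carrier_mat[of _ n n _ n]\<close>)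
  ultimately show ?thesis using B by (auto simp: GL_int_iff)
qed

lemma burau_gen_commute:
  assumes "i + 2 \<le> j" "j + 1 < n"
  shows "burau_gen n i * burau_gen n j = burau_gen n j * burau_gen n i"
proof (rule mat_eq_by_action)
  fix v :: "int vec" assume v: "v \<in> carrier_vec n"
  have "burau_gen n k * burau_gen n l *\<^sub>v v = burau_gen n k *\<^sub>v (burau_gen n l *\<^sub>v v)" for k l
    using v by (intro assoc_mult_mat_vec[of _ n n _ n]) auto
  then show "burau_gen n i * burau_gen n j *\<^sub>v v = burau_gen n j * burau_gen n i *\<^sub>v v"
    using v assms by (simp add: burau_gen_action) (auto intro!: eq_vecI)
qed (auto intro: mult_carrier_mat[of _ n n _ n])

lemma burau_gen_braid:
  assumes "i + 2 < n"
  shows "burau_gen n i * (burau_gen n (i + 1) * burau_gen n i)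
    = burau_gen n (i + 1) * (burau_gen n i * burau_gen n (i + 1))"
proof (rule mat_eq_by_action)
  fix v :: "int vec" assume v: "v \<in> carrier_vec n"
  have "burau_gen n k * (burau_gen n l * burau_gen n m) *\<^sub>v v
      = burau_gen n k *\<^sub>v (burau_gen n l *\<^sub>v (burau_gen n m *\<^sub>v v))" for k l m
    using v by (subst assoc_mult_mat_vec[of _ n n _ n])
      (auto intro: mult_carrier_mat[of _ n n _ n] simp: assoc_mult_mat_vec[of "burau_gen n l" n n "burau_gen n m" n])
  then show "burau_gen n i * (burau_gen n (i + 1) * burau_gen n i) *\<^sub>v v
    = burau_gen n (i + 1) * (burau_gen n i * burau_gen n (i + 1)) *\<^sub>v v"
    using v assms by (simp add: burau_gen_action) (auto intro!: eq_vecI)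
qed (auto intro!: mult_carrier_mat[of _ n n _ n])

lemma burau_letter_GL: "fst l < n - 1 \<Longrightarrow> burau_letter n l \<in> carrier (GL_int n)"
  using group.inv_closed[OF group_GL_int] burau_gen_GL[of "fst l" n]
  by (auto simp: burau_letter_def split: prod.splits)

lemma burau_word_simps [simp]:
  "burau_word n [] = 1\<^sub>m n" "burau_word n (l # w) = burau_letter n l * burau_word n w"
  by (simp_all add: burau_word_def)

lemma burau_word_GL: "w \<in> braid_words n \<Longrightarrow> burau_word n w \<in> carrier (GL_int n)"
proof (induction w)
  case Nil
  show ?case using group.is_monoid[OF group_GL_int] monoid.one_closed by fastforce
next
  case (Cons l w)
  then show ?case
    using monoid.m_closed[OF group.is_monoid[OF group_GL_int], of "burau_letter n l" n "burau_word n w"]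
    by (simp add: burau_letter_GL)
qed

lemma burau_word_append:
  assumes "u \<in> braid_words n" "w \<in> braid_words n"
  shows "burau_word n (u @ w) = burau_word n u * burau_word n w"
  using assms
proof (induction u)
  case Nil
  then show ?case using GL_int_mat[OF burau_word_GL[of w n]] by simp
next
  case (Cons l u)
  then show ?case
    using GL_int_mat[OF burau_word_GL[of u n]] GL_int_mat[OF burau_word_GL[of w n]]
      GL_int_mat[OF burau_letter_GL[of l n]]
    by (simp add: assoc_mult_mat[of _ n n _ n _ n])
qed

lemma burau_word_cong: "braid_eq n u v \<Longrightarrow> burau_word n u = burau_word n v"
proof (induction rule: braid_eq.induct)
  case (eq_context u v x y)
  then show ?case by (simp add: burau_word_append braid_eq_words)
next
  case (free_cancel i e)
  then have "burau_gen n i \<in> carrier (GL_int n)" by (intro burau_gen_GL) simp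
  then have "burau_gen n i * inv\<^bsub>GL_int n\<^esub> burau_gen n i = 1\<^sub>m n"
    "inv\<^bsub>GL_int n\<^esub> burau_gen n i * burau_gen n i = 1\<^sub>m n"
    "inv\<^bsub>GL_int n\<^esub> burau_gen n i \<in> carrier_mat n n"
    using group.r_inv[OF group_GL_int, of "burau_gen n i" n]
      group.l_inv[OF group_GL_int, of "burau_gen n i" n]
      GL_int_mat[OF group.inv_closed[OF group_GL_int, of "burau_gen n i" n]] by simp_all
  then show ?case by (cases e) (simp_all add: burau_letter_def right_mult_one_mat[of _ n n])
next
  case (far_commute i j)
  then show ?case
    using burau_gen_commute[of i j n] by (simp add: burau_letter_def right_mult_one_mat[of _ n n])
next
  case (braid_move i)
  then show ?case
    using burau_gen_braid[of i n] by (simp add: burau_letter_def right_mult_one_mat[of _ n n])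
qed auto

lemma burau_class:
  assumes "w \<in> braid_words n"
  shows "burau n (braid_rel n `` {w}) = burau_word n w"
proof -
  have "w \<in> braid_rel n `` {w}" using braid_eq.eq_refl[OF assms] by (simp add: braid_rel_def)
  moreover have "burau_word n v = burau_word n w" if "v \<in> braid_rel n `` {w}" for v
    using burau_word_cong[of n w v] that by (simp add: braid_rel_def)
  ultimately have "burau_word n ` (braid_rel n `` {w}) = {burau_word n w}" by blast
  then show ?thesis by (simp add: burau_def)
qed

lemma burau_artin_gen: "i < n - 1 \<Longrightarrow> burau n (artin_gen n i) = burau_gen n i"
  by (simp add: artin_gen_def burau_class burau_letter_def right_mult_one_mat[of _ n n])

lemma burau_hom: "burau n \<in> hom (braid_group n) (GL_int n)"
  by (rule homI)
     (auto elim!: braid_carrierE simp: burau_class burau_word_GL braid_mult_class burau_word_append)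


section \<open>The target group and its congruence subgroups\<close>

text \<open>
  The signs are \<open>(-1)\<^bsup>i+j+1\<^esup>\<close> above and \<open>(-1)\<^bsup>i+j\<^esup>\<close> below the diagonal;
  shifting both indices by one does not change the parity of \<open>i + j\<close>.
\<close>

definition form_coeff :: "nat \<Rightarrow> nat \<Rightarrow> int" where
  "form_coeff i j = (if i < j then (-1) ^ (i + j + 1) else if i = j then 0 else (-1) ^ (i + j))"

definition form :: "nat \<Rightarrow> int vec \<Rightarrow> int vec \<Rightarrow> int" where
  "form n v w = (\<Sum>i<n. \<Sum>j<n. v $ i * w $ j * form_coeff i j)"

lemma form_add_left:
  "u \<in> carrier_vec n \<Longrightarrow> v \<in> carrier_vec n \<Longrightarrow> form n (u + v) w = form n u w + form n v w"
  by (simp add: form_def sum.distrib algebra_simps)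

lemma form_smult_left: "v \<in> carrier_vec n \<Longrightarrow> form n (a \<cdot>\<^sub>v v) w = a * form n v w"
  by (simp add: form_def sum_distrib_left algebra_simps)

lemma form_antisym: "form n v w = - form n w v"
proof -
  have *: "form_coeff i j = - form_coeff j i" for i j
    by (auto simp: form_coeff_def add.commute)
  have **: "v $ i * w $ j * form_coeff i j = - (w $ j * v $ i * form_coeff j i)" for i j
    by (subst *[of i j]) simp
  have "form n v w = (\<Sum>i<n. \<Sum>j<n. - (w $ j * v $ i * form_coeff j i))"
    unfolding form_def
    by (rule sum.cong[OF refl], rule sum.cong[OF refl], rule **)
  also have "\<dots> = (\<Sum>j<n. \<Sum>i<n. - (w $ j * v $ i * form_coeff j i))" by (rule sum.swap)
  finally show ?thesis by (simp add: form_def sum_negf)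
qed

lemma form_transvection:
  assumes "i + 1 < n" "v \<in> carrier_vec n"
  shows "form n v (unit_vec n i + unit_vec n (i + 1)) = v $ i - v $ (i + 1)"
proof -
  have "form n v (unit_vec n i + unit_vec n (i + 1))
      = (\<Sum>r<n. \<Sum>c<n. (if c = i then v $ r * form_coeff r c else 0)
          + (if c = i + 1 then v $ r * form_coeff r c else 0))"
    unfolding form_def using assms(1) Suc_lessD[of i n] by (intro sum.cong refl) auto
  also have "\<dots> = (\<Sum>r<n. v $ r * (form_coeff r i + form_coeff r (i + 1)))"
    by (rule sum.cong[OF refl]) (use assms(1) in \<open>simp add: sum.distrib algebra_simps\<close>)
  also have "\<dots> = (\<Sum>r<n. (if r = i then v $ r else 0) + (if r = i + 1 then - v $ r else 0))"
    by (intro sum.cong refl) (auto simp: form_coeff_def)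
  also have "\<dots> = v $ i - v $ (i + 1)" using assms(1) by (simp add: sum.distrib)
  finally show ?thesis .
qed

lemma burau_gen_form:
  assumes i: "i + 1 < n" and v: "v \<in> carrier_vec n" and w: "w \<in> carrier_vec n"
  shows "form n (burau_gen n i *\<^sub>v v) (burau_gen n i *\<^sub>v w) = form n v w"
proof -
  define u :: "int vec" where "u = unit_vec n i + unit_vec n (i + 1)"
  have u: "u \<in> carrier_vec n" by (simp add: u_def)
  have act: "burau_gen n i *\<^sub>v x = x + (x $ i - x $ (i + 1)) \<cdot>\<^sub>v u" if "x \<in> carrier_vec n" for x
    using that i by (auto simp: burau_gen_action u_def intro!: eq_vecI)
  have bil: "form n (x + a \<cdot>\<^sub>v u) y = form n x y + a * form n u y" if "x \<in> carrier_vec n" for x y a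
    using that u by (simp add: form_add_left form_smult_left)
  have uu: "form n u u = 0" using form_antisym[of n u u] by simp
  have xu: "form n x u = x $ i - x $ (i + 1)" if "x \<in> carrier_vec n" for x
    using form_transvection[OF i that] by (simp add: u_def)
  have bil': "form n y (x + a \<cdot>\<^sub>v u) = form n y x + a * form n y u" if "x \<in> carrier_vec n" for x y a
    using bil[OF that, of a y] form_antisym[of n y] by simp
  have "form n u w = - (w $ i - w $ (i + 1))" using xu[OF w] form_antisym[of n u w] by simp
  moreover have "form n (v + a \<cdot>\<^sub>v u) (w + b \<cdot>\<^sub>v u) = form n v w + b * form n v u + a * form n u w" for a b
    using bil[OF v] bil'[OF w] uu by simp
  ultimately show ?thesis
    by (simp only: act[OF v] act[OF w] xu[OF v]) (simp add: algebra_simps)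
qed

definition v_vec :: "nat \<Rightarrow> int vec" where
  "v_vec n = vec n (\<lambda>_. 1)"

definition w_vec :: "nat \<Rightarrow> int vec" where
  "w_vec n = vec n (\<lambda>i. (-1) ^ i)"

text \<open>
  \<open>Gamma n\<close> consists of \<open>n \<times> n\<close> matrices; it is the group commonly denoted \<open>\<Gamma>\<^bsub>n-1\<^esub>\<close>.
  The condition \<open>w\<^sup>T A = w\<^sup>T\<close> is stated in transposed form.
\<close>

definition Gamma :: "nat \<Rightarrow> int mat monoid" where
  "Gamma n = (GL_int n)\<lparr>carrier := {A \<in> carrier (GL_int n).
     (\<forall>v \<in> carrier_vec n. \<forall>w \<in> carrier_vec n. form n (A *\<^sub>v v) (A *\<^sub>v w) = form n v w) \<and>
     A *\<^sub>v v_vec n = v_vec n \<and>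
     transpose_mat A *\<^sub>v w_vec n = w_vec n}\<rparr>"

definition Gamma_cong :: "nat \<Rightarrow> nat \<Rightarrow> int mat set" where
  "Gamma_cong n l = {A \<in> carrier (Gamma n).
     \<forall>i<n. \<forall>j<n. [A $$ (i, j) = 1\<^sub>m n $$ (i, j)] (mod int l)}"

lemma Gamma_simps [simp]:
  "A \<otimes>\<^bsub>Gamma n\<^esub> B = A * B" "\<one>\<^bsub>Gamma n\<^esub> = 1\<^sub>m n"
  by (simp_all add: Gamma_def)

lemma Gamma_mat: "A \<in> carrier (Gamma n) \<Longrightarrow> A \<in> carrier_mat n n"
  by (simp add: Gamma_def GL_int_mat)

lemma subgroup_Gamma: "subgroup (carrier (Gamma n)) (GL_int n)"
proof (rule group.subgroupI[OF group_GL_int])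
  let ?G = "GL_int n"
  note [simp] = v_vec_def w_vec_def
  have 1: "1\<^sub>m n \<in> carrier (Gamma n)"
    using group.is_monoid[OF group_GL_int, of n] monoid.one_closed[of ?G] by (simp add: Gamma_def)
  then show "carrier (Gamma n) \<noteq> {}" by auto
  show "carrier (Gamma n) \<subseteq> carrier ?G" by (auto simp: Gamma_def)
  fix A assume A: "A \<in> carrier (Gamma n)"
  then have AG: "A \<in> carrier ?G" and Am: "A \<in> carrier_mat n n" by (simp_all add: Gamma_def GL_int_mat)
  show "A \<otimes>\<^bsub>?G\<^esub> B \<in> carrier (Gamma n)" if B: "B \<in> carrier (Gamma n)" for B
  proof -
    have BG: "B \<in> carrier ?G" and Bm: "B \<in> carrier_mat n n" using B by (simp_all add: Gamma_def GL_int_mat)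
    have "A * B \<in> carrier ?G" using monoid.m_closed[OF group.is_monoid[OF group_GL_int] AG BG] by simp
    moreover have "A * B *\<^sub>v v = A *\<^sub>v (B *\<^sub>v v)" if "v \<in> carrier_vec n" for v
      using Am Bm that by (rule assoc_mult_mat_vec)
    moreover have "transpose_mat (A * B) *\<^sub>v w_vec n = transpose_mat B *\<^sub>v (transpose_mat A *\<^sub>v w_vec n)"
      using Am Bm by (subst transpose_mult[OF Am Bm], intro assoc_mult_mat_vec) auto
    ultimately show ?thesis using A B Am Bm by (simp add: Gamma_def del: v_vec_def w_vec_def) (simp add: v_vec_def)
  qed
  let ?I = "inv\<^bsub>?G\<^esub> A"
  have IG: "?I \<in> carrier ?G" using group.inv_closed[OF group_GL_int AG] .
  then have Im: "?I \<in> carrier_mat n n" by (rule GL_int_mat)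
  have IA: "?I * A = 1\<^sub>m n" and AI: "A * ?I = 1\<^sub>m n"
    using group.l_inv[OF group_GL_int AG] group.r_inv[OF group_GL_int AG] by simp_all
  have IAv: "?I *\<^sub>v (A *\<^sub>v v) = v" and AIv: "A *\<^sub>v (?I *\<^sub>v v) = v" if "v \<in> carrier_vec n" for v
    using that Am Im IA AI by (simp_all flip: assoc_mult_mat_vec[of _ n n _ n])
  have IAt: "transpose_mat ?I *\<^sub>v (transpose_mat A *\<^sub>v v) = v" if "v \<in> carrier_vec n" for v
  proof -
    have "transpose_mat ?I *\<^sub>v (transpose_mat A *\<^sub>v v) = transpose_mat ?I * transpose_mat A *\<^sub>v v"
      using that Am Im by (intro assoc_mult_mat_vec[symmetric]) auto
    also have "transpose_mat ?I * transpose_mat A = 1\<^sub>m n"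
      using transpose_mult[OF Am Im] AI by simp
    finally show ?thesis using that by simp
  qed
  have "form n (?I *\<^sub>v v) (?I *\<^sub>v w) = form n v w" if "v \<in> carrier_vec n" "w \<in> carrier_vec n" for v w
  proof -
    have "?I *\<^sub>v v \<in> carrier_vec n" "?I *\<^sub>v w \<in> carrier_vec n" using Im that by auto
    then have "form n (A *\<^sub>v (?I *\<^sub>v v)) (A *\<^sub>v (?I *\<^sub>v w)) = form n (?I *\<^sub>v v) (?I *\<^sub>v w)"
      using A by (simp add: Gamma_def)
    then show ?thesis using that AIv by simp
  qed
  moreover have "?I *\<^sub>v v_vec n = v_vec n" using A IAv[of "v_vec n"] by (simp add: Gamma_def del: v_vec_def) (simp add: v_vec_def)
  moreover have "transpose_mat ?I *\<^sub>v w_vec n = w_vec n"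
    using A IAt[of "w_vec n"] by (simp add: Gamma_def del: w_vec_def) (simp add: w_vec_def)
  ultimately show "?I \<in> carrier (Gamma n)" using IG by (simp add: Gamma_def)
qed

lemma group_Gamma: "group (Gamma n)"
proof -
  have "Gamma n = (GL_int n)\<lparr>carrier := carrier (Gamma n)\<rparr>" by (simp add: Gamma_def)
  then show ?thesis using group.subgroup_imp_group[OF group_GL_int subgroup_Gamma, of n] by simp
qed

lemma burau_gen_Gamma:
  assumes "i + 1 < n"
  shows "burau_gen n i \<in> carrier (Gamma n)"
proof -
  have "burau_gen n i *\<^sub>v v_vec n = v_vec n"
    using assms by (subst burau_gen_action) (auto simp: v_vec_def intro!: eq_vecI)
  moreover have "transpose_mat (burau_gen n i) *\<^sub>v w_vec n = w_vec n"
  proof (rule eq_vecI)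
    fix c assume "c < dim_vec (w_vec n)"
    then have c: "c < n" by (simp add: w_vec_def)
    have "(transpose_mat (burau_gen n i) *\<^sub>v w_vec n) $ c = (\<Sum>r<n. burau_gen n i $$ (r, c) * (-1) ^ r)"
      using c by (simp add: scalar_prod_def lessThan_atLeast0 burau_gen_def w_vec_def)
    also have "\<dots> = (\<Sum>r<n. (if r = c then (-1) ^ r else 0)
        + (if r = i then (if c = i then 1 else if c = i + 1 then -1 else 0) * (-1) ^ r else 0)
        + (if r = i + 1 then (if c = i then 1 else if c = i + 1 then -1 else 0) * (-1) ^ r else 0))"
      using c assms by (intro sum.cong) (auto simp: burau_gen_def)
    also have "\<dots> = (-1) ^ c" using c assms by (simp add: sum.distrib)
    finally show "(transpose_mat (burau_gen n i) *\<^sub>v w_vec n) $ c = w_vec n $ c"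
      using c by (simp add: w_vec_def)
  qed (simp add: burau_gen_def w_vec_def)
  ultimately show ?thesis
    using assms by (simp add: Gamma_def burau_gen_GL burau_gen_form)
qed

lemma burau_Gamma: "burau n \<in> hom (braid_group n) (Gamma n)"
proof -
  have letter: "burau_letter n l \<in> carrier (Gamma n)" if "fst l < n - 1" for l
    using that burau_gen_Gamma[of "fst l" n] subgroup.m_inv_closed[OF subgroup_Gamma]
    by (auto simp: burau_letter_def split: prod.splits)
  have "burau_word n w \<in> carrier (Gamma n)" if "w \<in> braid_words n" for w
    using that
  proof (induction w)
    case Nil
    then show ?case using subgroup.one_closed[OF subgroup_Gamma, of n] by simp
  next
    case (Cons l w)
    then show ?case
      using subgroup.m_closed[OF subgroup_Gamma, of "burau_letter n l" n "burau_word n w"] letter by simp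
  qed
  then have "burau n b \<in> carrier (Gamma n)" if "b \<in> carrier (braid_group n)" for b
    using that by (auto elim!: braid_carrierE simp: burau_class)
  then show ?thesis using burau_hom[of n] by (auto simp: hom_def)
qed

lemma normal_Gamma_cong: "Gamma_cong n l \<lhd> Gamma n"
proof -
  interpret G: group "Gamma n" by (rule group_Gamma)
  have mat_cong_mult: "[(A * B) $$ (i, j) = (C * D) $$ (i, j)] (mod int l)"
    if "A \<in> carrier_mat n n" "B \<in> carrier_mat n n" "C \<in> carrier_mat n n" "D \<in> carrier_mat n n"
      "\<forall>i<n. \<forall>j<n. [A $$ (i, j) = C $$ (i, j)] (mod int l)"
      "\<forall>i<n. \<forall>j<n. [B $$ (i, j) = D $$ (i, j)] (mod int l)" "i < n" "j < n" for A B C D :: "int mat" and i j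
    using that by (auto simp: scalar_prod_def intro!: cong_sum cong_mult)
  have one: "1\<^sub>m n \<in> carrier_mat n n" by simp
  have conj: "x * h * y \<in> Gamma_cong n l" if x: "x \<in> carrier (Gamma n)" and y: "y \<in> carrier (Gamma n)"
    and h: "h \<in> Gamma_cong n l" and xy: "x * y = 1\<^sub>m n" for x y h
  proof -
    have hG: "h \<in> carrier (Gamma n)" using h by (simp add: Gamma_cong_def)
    note m = Gamma_mat[OF x] Gamma_mat[OF y] Gamma_mat[OF hG]
    have xh: "\<forall>i<n. \<forall>j<n. [(x * h) $$ (i, j) = (x * 1\<^sub>m n) $$ (i, j)] (mod int l)"
      by (intro allI impI, rule mat_cong_mult) (use m h in \<open>auto simp: Gamma_cong_def\<close>)
    have "\<forall>i<n. \<forall>j<n. [(x * h * y) $$ (i, j) = (x * 1\<^sub>m n * y) $$ (i, j)] (mod int l)"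
      by (intro allI impI, rule mat_cong_mult) (use m xh in \<open>auto intro: mult_carrier_mat[of _ n n _ n]\<close>)
    moreover have "x * h * y \<in> carrier (Gamma n)"
      using G.m_closed[OF G.m_closed[OF x hG] y] by simp
    ultimately show ?thesis using m xy by (simp add: Gamma_cong_def)
  qed
  have "subgroup (Gamma_cong n l) (Gamma n)"
  proof (rule G.subgroupI)
    show "Gamma_cong n l \<subseteq> carrier (Gamma n)" by (auto simp: Gamma_cong_def)
    show "Gamma_cong n l \<noteq> {}" using G.one_closed by (auto simp: Gamma_cong_def)
    fix a assume a: "a \<in> Gamma_cong n l"
    then have aG: "a \<in> carrier (Gamma n)" by (simp add: Gamma_cong_def)
    have IG: "inv\<^bsub>Gamma n\<^esub> a \<in> carrier (Gamma n)" using aG by simp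
    have "[(inv\<^bsub>Gamma n\<^esub> a * a) $$ (i, j) = (inv\<^bsub>Gamma n\<^esub> a * 1\<^sub>m n) $$ (i, j)] (mod int l)"
      if "i < n" "j < n" for i j
      by (rule mat_cong_mult) (use a that Gamma_mat[OF aG] Gamma_mat[OF IG] in \<open>auto simp: Gamma_cong_def\<close>)
    moreover have "inv\<^bsub>Gamma n\<^esub> a * a = 1\<^sub>m n" using G.l_inv[OF aG] by simp
    ultimately have "[1\<^sub>m n $$ (i, j) = (inv\<^bsub>Gamma n\<^esub> a) $$ (i, j)] (mod int l)"
      if "i < n" "j < n" for i j
      using that Gamma_mat[OF IG] by (metis right_mult_one_mat)
    then show "inv\<^bsub>Gamma n\<^esub> a \<in> Gamma_cong n l"
      unfolding Gamma_cong_def using IG cong_sym by blast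
    fix b assume b: "b \<in> Gamma_cong n l"
    then have bG: "b \<in> carrier (Gamma n)" by (simp add: Gamma_cong_def)
    have "[(a * b) $$ (i, j) = (1\<^sub>m n * 1\<^sub>m n) $$ (i, j)] (mod int l)" if "i < n" "j < n" for i j
      by (rule mat_cong_mult) (use a b that Gamma_mat[OF aG] Gamma_mat[OF bG] in \<open>auto simp: Gamma_cong_def\<close>)
    then show "a \<otimes>\<^bsub>Gamma n\<^esub> b \<in> Gamma_cong n l"
      using G.m_closed[OF aG bG] by (simp add: Gamma_cong_def)
  qed
  then show ?thesis
    using conj G.r_inv by (intro G.normal_invI) (auto)
qed

definition Gamma_quot :: "nat \<Rightarrow> nat \<Rightarrow> int mat \<Rightarrow> int mat set" where
  "Gamma_quot n l A = Gamma_cong n l #>\<^bsub>Gamma n\<^esub> A"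


section \<open>The rank two groups and the low-dimensional identifications\<close>

definition SL2 :: "int mat monoid" where
  "SL2 = (GL_int 2)\<lparr>carrier := {A \<in> carrier (GL_int 2). det A = 1}\<rparr>"

definition symp2 :: "int vec \<Rightarrow> int vec \<Rightarrow> int" where
  "symp2 v w = v $ 0 * w $ 1 - v $ 1 * w $ 0"

definition Sp2 :: "int mat monoid" where
  "Sp2 = (GL_int 2)\<lparr>carrier := {A \<in> carrier (GL_int 2).
     \<forall>v \<in> carrier_vec 2. \<forall>w \<in> carrier_vec 2. symp2 (A *\<^sub>v v) (A *\<^sub>v w) = symp2 v w}\<rparr>"

definition stabilizer :: "int mat monoid \<Rightarrow> int vec \<Rightarrow> int mat monoid" where
  "stabilizer G x = G\<lparr>carrier := {A \<in> carrier G. A *\<^sub>v x = x}\<rparr>"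

text \<open>
  If the columns of \<open>U\<close> form a basis of an \<open>A\<close>-invariant sublattice, then \<open>restr_matrix U A\<close>
  is the matrix of the restriction of \<open>A\<close> to that sublattice in this basis.
\<close>

definition restr_matrix :: "int mat \<Rightarrow> int mat \<Rightarrow> int mat" where
  "restr_matrix U A = (THE M. M \<in> carrier_mat (dim_col U) (dim_col U) \<and> A * U = U * M)"

text \<open>The symplectic basis \<open>v\<^sub>2, e\<^sub>2\<close> of \<open>\<int>\<^sup>2\<close>.\<close>

definition basis2 :: "int mat" where
  "basis2 = mat_of_cols 2 [v_vec 2, unit_vec 2 1]"

lemma basis2_symplectic: "form 2 (col basis2 0) (col basis2 1) = 1"
  by (simp add: basis2_def form_def v_vec_def form_coeff_def numeral_2_eq_2)

lemma basis2_span: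
  assumes "x \<in> carrier_vec 2"
  shows "\<exists>!y. y \<in> carrier_vec 2 \<and> x = basis2 *\<^sub>v y"
proof -
  have dims: "basis2 \<in> carrier_mat 2 2"
    by (rule carrier_matI) (simp_all add: basis2_def)
  have entries: "basis2 $$ (0, 0) = 1" "basis2 $$ (0, 1) = 0" "basis2 $$ (1, 0) = 1" "basis2 $$ (1, 1) = 1"
    by (simp_all add: basis2_def v_vec_def mat_of_cols_index)
  have eq2: "a = b \<longleftrightarrow> a $ 0 = b $ 0 \<and> a $ 1 = b $ 1"
    if "a \<in> carrier_vec 2" "b \<in> carrier_vec 2" for a b :: "int vec"
    using that by (auto intro!: eq_vecI simp: less_2_cases_iff)
  have act: "basis2 *\<^sub>v y \<in> carrier_vec 2" "(basis2 *\<^sub>v y) $ 0 = y $ 0" "(basis2 *\<^sub>v y) $ 1 = y $ 0 + y $ 1"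
    if "y \<in> carrier_vec 2" for y
    using that dims entries by (auto simp: scalar_prod_def numeral_2_eq_2)
  have iff: "x = basis2 *\<^sub>v y \<longleftrightarrow> y $ 0 = x $ 0 \<and> y $ 1 = x $ 1 - x $ 0"
    if "y \<in> carrier_vec 2" for y
    using act[OF that] by (subst eq2[OF assms act(1)[OF that]]) auto
  define z where "z = vec 2 (\<lambda>k. if k = 0 then x $ 0 else x $ 1 - x $ 0)"
  have z: "z \<in> carrier_vec 2" "z $ 0 = x $ 0" "z $ 1 = x $ 1 - x $ 0" by (simp_all add: z_def)
  show ?thesis
  proof (rule ex1I[of _ z])
    show "z \<in> carrier_vec 2 \<and> x = basis2 *\<^sub>v z" using z iff[OF z(1)] by simp
    show "y = z" if "y \<in> carrier_vec 2 \<and> x = basis2 *\<^sub>v y" for y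
      using that iff[of y] eq2[of y z] z by simp
  qed
qed

text \<open>The symplectic basis \<open>e\<^sub>1 + e\<^sub>2, e\<^sub>2 + e\<^sub>3\<close> of the kernel of \<open>w\<^sub>3\<^sup>T\<close> in \<open>\<int>\<^sup>3\<close>.\<close>

definition basis3 :: "int mat" where
  "basis3 = mat_of_cols 3 [unit_vec 3 0 + unit_vec 3 1, unit_vec 3 1 + unit_vec 3 2]"

lemma basis3_symplectic: "form 3 (col basis3 0) (col basis3 1) = 1"
  by (simp add: basis3_def form_def form_coeff_def numeral_3_eq_3)

lemma basis3_span:
  assumes "x \<in> carrier_vec 3"
  shows "w_vec 3 \<bullet> x = 0 \<longleftrightarrow> (\<exists>!y. y \<in> carrier_vec 2 \<and> x = basis3 *\<^sub>v y)"
proof -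
  have dims: "basis3 \<in> carrier_mat 3 2"
    by (rule carrier_matI) (simp_all add: basis3_def)
  have entries: "basis3 $$ (0, 0) = 1" "basis3 $$ (0, 1) = 0" "basis3 $$ (1, 0) = 1" "basis3 $$ (1, 1) = 1" "basis3 $$ (2, 0) = 0" "basis3 $$ (2, 1) = 1"
    by (simp_all add: basis3_def v_vec_def mat_of_cols_index)
  have eq2: "a = b \<longleftrightarrow> a $ 0 = b $ 0 \<and> a $ 1 = b $ 1"
    if "a \<in> carrier_vec 2" "b \<in> carrier_vec 2" for a b :: "int vec"
    using that by (auto intro!: eq_vecI simp: less_2_cases_iff)
  have eq3: "a = b \<longleftrightarrow> a $ 0 = b $ 0 \<and> a $ 1 = b $ 1 \<and> a $ 2 = b $ 2"
    if "a \<in> carrier_vec 3" "b \<in> carrier_vec 3" for a b :: "int vec"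
    using that by (auto intro!: eq_vecI simp: numeral_3_eq_3 numeral_2_eq_2 less_Suc_eq)
  have act: "basis3 *\<^sub>v y \<in> carrier_vec 3" "(basis3 *\<^sub>v y) $ 0 = y $ 0"
    "(basis3 *\<^sub>v y) $ 1 = y $ 0 + y $ 1" "(basis3 *\<^sub>v y) $ 2 = y $ 1"
    if "y \<in> carrier_vec 2" for y
    using that dims entries by (auto simp: scalar_prod_def numeral_2_eq_2 numeral_3_eq_3)
  have w: "w_vec 3 \<bullet> x = x $ 0 - x $ 1 + x $ 2"
    using assms by (simp add: w_vec_def scalar_prod_def numeral_2_eq_2 numeral_3_eq_3)
  have iff: "x = basis3 *\<^sub>v y \<longleftrightarrow> w_vec 3 \<bullet> x = 0 \<and> y $ 0 = x $ 0 \<and> y $ 1 = x $ 2"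
    if "y \<in> carrier_vec 2" for y
    using act[OF that] by (subst eq3[OF assms act(1)[OF that]]) (auto simp: w)
  define z where "z = vec 2 (\<lambda>k. if k = 0 then x $ 0 else x $ 2)"
  have z: "z \<in> carrier_vec 2" "z $ 0 = x $ 0" "z $ 1 = x $ 2" by (simp_all add: z_def)
  show ?thesis
  proof
    assume 0: "w_vec 3 \<bullet> x = 0"
    show "\<exists>!y. y \<in> carrier_vec 2 \<and> x = basis3 *\<^sub>v y"
    proof (rule ex1I[of _ z])
      show "z \<in> carrier_vec 2 \<and> x = basis3 *\<^sub>v z" using 0 z iff[OF z(1)] by simp
      show "y = z" if "y \<in> carrier_vec 2 \<and> x = basis3 *\<^sub>v y" for y
        using that iff[of y] eq2[of y z] z by simp
    qed
  qed (use iff in blast)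
qed

end

(*
  Under the Burau matrices a vector transforms by (a, b) -> (2a - b, a) in adjacent coordinates,
  which is the Hurwitz action on tuples of reflections of the infinite dihedral group. A Euclidean
  algorithm on triples shows that an integer tuple with alternating sum 1, exactly one odd entry and
  no common divisor d > 1 of the numbers x_i - 1 lies in the Hurwitz orbit of (1, 0, ..., 0). The
  first column of a matrix A in Gamma that is a permutation matrix mod 2 is such a tuple, so A can be
  multiplied by a Burau matrix to fix the first basis vector. The first coordinate of x is a
  combination of <e_1, x> and w^T x, so the new matrix also fixes the first coordinate, and one
  continues with the remaining ones. Hence the image of Burau consists of the elements of Gamma that
  are permutation matrices mod 2. For n = 2, 3 a parity count shows that this is all of Gamma.
*)
theory Submission
  imports Defs
begin

section \<open>Hurwitz equivalence of integer tuples\<close>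

text \<open>An entry x stands for the reflection t -> 2x - t, and a move replaces neighbours a, b by
  the conjugate of b by a, followed by a. The product of all reflections is thus preserved; its
  value at 0 is twice the alternating sum. What makes the normal form reachable is that a repeated
  pair y, y has product 1: it can travel through the tuple and be conjugated by any other entry.
  Moves also preserve the number of odd entries, so a column with several odd entries can never be
  carried to a basis vector; this is where the condition mod 2 enters. The other two properties of a
  column hold throughout Gamma: the alternating sum comes from w_n, and the absence of a common
  divisor from A being invertible and fixing v_n. The induction keeps n x n matrices and fixes more
  and more basis vectors instead of passing to a smaller Gamma. Once k basis vectors are fixed, only
  generators with index at least k are applied, and these do not disturb them.\<close>

inductive hurwitz :: "int list \<Rightarrow> int list \<Rightarrow> bool" where
  hurwitz_refl: "hurwitz xs xs"
| hurwitz_sym: "hurwitz xs ys \<Longrightarrow> hurwitz ys xs"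
| hurwitz_trans [trans]: "hurwitz xs ys \<Longrightarrow> hurwitz ys zs \<Longrightarrow> hurwitz xs zs"
| hurwitz_move: "hurwitz (us @ [a, b] @ vs) (us @ [2 * a - b, a] @ vs)"

lemma hurwitz_context: "hurwitz xs ys \<Longrightarrow> hurwitz (us @ xs @ vs) (us @ ys @ vs)"
proof (induction rule: hurwitz.induct)
  case (hurwitz_move us' a b vs')
  then show ?case using hurwitz.hurwitz_move[of "us @ us'" a b "vs' @ vs"] by simp
next
  case (hurwitz_sym xs ys)
  show ?case by (rule hurwitz.hurwitz_sym[OF hurwitz_sym.IH])
next
  case (hurwitz_trans xs ys zs)
  show ?case by (rule hurwitz.hurwitz_trans[OF hurwitz_trans.IH])
qed (rule hurwitz_refl)

lemma hurwitz_Cons: "hurwitz xs ys \<Longrightarrow> hurwitz (x # xs) (x # ys)"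
  using hurwitz_context[of xs ys "[x]" "[]"] by simp

lemma hurwitz_append_left: "hurwitz xs ys \<Longrightarrow> hurwitz (us @ xs) (us @ ys)"
  using hurwitz_context[of xs ys us "[]"] by simp

lemma hurwitz_append_right: "hurwitz xs ys \<Longrightarrow> hurwitz (xs @ vs) (ys @ vs)"
  using hurwitz_context[of xs ys "[]" vs] by simp

lemma hurwitz_length: "hurwitz xs ys \<Longrightarrow> length xs = length ys"
  by (induction rule: hurwitz.induct) auto

section \<open>Invariants of Hurwitz equivalence\<close>

fun alt_sum :: "int list \<Rightarrow> int" where
  "alt_sum [] = 0"
| "alt_sum (x # xs) = x - alt_sum xs"

lemma alt_sum_append: "alt_sum (xs @ ys) = alt_sum xs + (-1) ^ length xs * alt_sum ys"
  by (induction xs) auto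

lemma hurwitz_alt_sum: "hurwitz xs ys \<Longrightarrow> alt_sum xs = alt_sum ys"
  by (induction rule: hurwitz.induct) (simp_all add: alt_sum_append)

lemma hurwitz_odd_count: "hurwitz xs ys \<Longrightarrow> length (filter odd xs) = length (filter odd ys)"
  by (induction rule: hurwitz.induct) auto

text \<open>A move keeps a - c and turns b - c into 2(a - c) - (b - c), up to order. With c = 1 this
  carries the divisor condition on a column over to its normal form.\<close>

lemma hurwitz_dvd:
  "hurwitz xs ys \<Longrightarrow> (\<forall>x\<in>set xs. d dvd x - c) \<longleftrightarrow> (\<forall>y\<in>set ys. d dvd y - c)"
proof (induction rule: hurwitz.induct)
  case (hurwitz_move us a b vs)
  have "d dvd 2 * a - b - c \<longleftrightarrow> d dvd b - c" if "d dvd a - c"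
  proof -
    have eq: "2 * a - b - c = 2 * (a - c) - (b - c)" by simp
    have "d dvd 2 * (a - c)" using that by (rule dvd_mult)
    then show ?thesis unfolding eq by (rule dvd_diff_right_iff)
  qed
  then show ?case by auto
qed simp_all

section \<open>Moves on pairs and triples\<close>

lemma hurwitz_shift_nat:
  "hurwitz [a, b] [a + int k * (a - b), b + int k * (a - b)]"
proof (induction k)
  case (Suc k)
  let ?a = "a + int k * (a - b)" and ?b = "b + int k * (a - b)"
  have "hurwitz [?a, ?b] [2 * ?a - ?b, ?a]"
    using hurwitz_move[of "[]" ?a ?b "[]"] by simp
  from hurwitz_trans[OF Suc this] show ?case by (simp add: algebra_simps)
qed (simp add: hurwitz_refl)

text \<open>A move on two entries preserves their difference, so it slides the pair by exactly that
  difference.\<close>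

lemma hurwitz_shift: "hurwitz [a, b] [a + k * (a - b), b + k * (a - b)]"
proof (cases "k \<ge> 0")
  case True
  then show ?thesis using hurwitz_shift_nat[of a b "nat k"] by simp
next
  case False
  \<comment> \<open>For negative \<open>k\<close> the forward shift starts from the target pair,
    which has the same difference, and is then reversed.\<close>
  then show ?thesis
    using hurwitz_sym[OF hurwitz_shift_nat[of "a + k * (a - b)" "b + k * (a - b)" "nat (- k)"]]
    by (simp add: algebra_simps)
qed

text \<open>Two equal reflections cancel, so the pair commutes with everything.\<close>

lemma hurwitz_pair_past: "hurwitz [y, y, z] [z, y, y]"
proof -
  have "hurwitz [y, y, z] [y, 2 * y - z, y]" using hurwitz_move[of "[y]" y z "[]"] by simp
  also have "hurwitz \<dots> [z, y, y]" using hurwitz_move[of "[]" y "2 * y - z" "[y]"] by simp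
  finally show ?thesis .
qed

text \<open>Conjugation of the pair by \<open>z\<close>: the reflected pair is slid past
  \<open>z\<close>, and then \<open>z\<close> is moved back through its two copies one at a time,
  each of which gets reflected.\<close>

lemma hurwitz_pair_reflect: "hurwitz [y, y, z] [2 * z - y, 2 * z - y, z]"
proof -
  let ?y = "2 * z - y"
  have "hurwitz [?y, ?y, z] [z, ?y, ?y]" by (rule hurwitz_pair_past)
  also have "hurwitz \<dots> [2 * z - ?y, z, ?y]" using hurwitz_move[of "[]" z ?y "[?y]"] by simp
  also have "hurwitz \<dots> [2 * z - ?y, 2 * z - ?y, z]"
    using hurwitz_move[of "[2 * z - ?y]" z ?y "[]"] by simp
  finally have "hurwitz [?y, ?y, z] [y, y, z]" by simp
  then show ?thesis by (rule hurwitz_sym)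
qed

lemma hurwitz_pair_past_list: "hurwitz ([y, y] @ zs) (zs @ [y, y])"
proof (induction zs)
  case (Cons z zs)
  have "hurwitz ([y, y] @ z # zs) ([z, y, y] @ zs)"
    using hurwitz_append_right[OF hurwitz_pair_past] by simp
  also have "hurwitz \<dots> (z # zs @ [y, y])" using hurwitz_Cons[OF Cons] by simp
  finally show ?case by simp
qed (simp add: hurwitz_refl)

text \<open>The position of \<open>z\<close> does not matter: the pair travels to \<open>z\<close>,
  is reflected there and travels back.\<close>

lemma hurwitz_pair_reflect_mem:
  assumes "z \<in> set zs"
  shows "hurwitz ([y, y] @ zs) ([2 * z - y, 2 * z - y] @ zs)"
proof -
  obtain us vs where zs: "zs = us @ z # vs" using split_list[OF assms] by blast
  have past: "hurwitz ([y, y] @ us @ z # vs) (us @ [y, y, z] @ vs)" for y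
    using hurwitz_append_right[OF hurwitz_pair_past_list[of y us], of "z # vs"] by simp
  note past[of y]
  also have "hurwitz (us @ [y, y, z] @ vs) (us @ [2 * z - y, 2 * z - y, z] @ vs)"
    by (rule hurwitz_context[OF hurwitz_pair_reflect])
  also note hurwitz_sym[OF past[of "2 * z - y"]]
  finally show ?thesis by (simp add: zs)
qed

text \<open>Euclidean algorithm on the differences a - b and b - c. Shifting one adjacent pair keeps
  its own difference and changes the other by a multiple of it; once a difference is zero, two
  neighbours agree.\<close>

lemma hurwitz_triple: "\<exists>y z. hurwitz [a, b, c] [y, y, z]"
proof (induction "nat (\<bar>a - b\<bar> + \<bar>b - c\<bar>)" arbitrary: a b c rule: less_induct)
  case less
  let ?p = "a - b" and ?q = "b - c"
  consider "?p = 0" | "?q = 0" | "?p \<noteq> 0" "?q \<noteq> 0" "\<bar>?p\<bar> \<ge> \<bar>?q\<bar>" | "?p \<noteq> 0" "?q \<noteq> 0" "\<bar>?p\<bar> < \<bar>?q\<bar>"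
    by linarith
  then show ?case
  proof cases
    case 1
    then have "hurwitz [a, b, c] [b, b, c]" by (simp add: hurwitz_refl)
    then show ?thesis by blast
  next
    case 2
    then have "hurwitz [a, b, c] [b, b, a]" using hurwitz_sym[OF hurwitz_pair_past[of b a]] by simp
    then show ?thesis by blast
  next
    case 3
    \<comment> \<open>Then \<open>k * ?q\<close> has the absolute value of \<open>?q\<close> and the
      sign of \<open>?p\<close>, so \<open>?p - k * ?q\<close> is smaller than \<open>?p\<close> in
      absolute value, while \<open>?q\<close> is unchanged.\<close>
    define k where "k = sgn ?p * sgn ?q"
    have h: "hurwitz [a, b, c] [a, b + k * ?q, c + k * ?q]"
      by (rule hurwitz_Cons[OF hurwitz_shift])
    have "\<bar>a - (b + k * ?q)\<bar> < \<bar>?p\<bar>" using 3 by (auto simp: k_def sgn_if)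
    then have "\<exists>y z. hurwitz [a, b + k * ?q, c + k * ?q] [y, y, z]" by (intro less) auto
    then show ?thesis using h hurwitz_trans by blast
  next
    case 4
    \<comment> \<open>The second difference becomes \<open>?q + k * ?p\<close>, where
      \<open>k * ?p\<close> has the sign opposite to \<open>?q\<close>.\<close>
    define k where "k = - sgn ?p * sgn ?q"
    have h: "hurwitz [a, b, c] [a + k * ?p, b + k * ?p, c]"
      using hurwitz_append_right[OF hurwitz_shift, of a b "[c]" k] by simp
    have "\<bar>b + k * ?p - c\<bar> < \<bar>?q\<bar>" using 4 by (auto simp: k_def sgn_if)
    then have "\<exists>y z. hurwitz [a + k * ?p, b + k * ?p, c] [y, y, z]" by (intro less) auto
    then show ?thesis using h hurwitz_trans by blast
  qed
qed

section \<open>Reduction to the canonical tuple\<close>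

fun double :: "int list \<Rightarrow> int list" where
  "double [] = []"
| "double (y # ys) = y # y # double ys"

lemma double_append [simp]: "double (xs @ ys) = double xs @ double ys"
  by (induction xs) auto

lemma set_double [simp]: "set (double ys) = set ys"
  by (induction ys) auto

lemma alt_sum_double [simp]: "alt_sum (double ys @ zs) = alt_sum zs"
  by (induction ys) auto

lemma length_double [simp]: "length (double ys) = 2 * length ys"
  by (induction ys) auto

lemma odd_count_double:
  "length (filter odd (double ys @ zs)) = 2 * length (filter odd ys) + length (filter odd zs)"
  by (induction ys) auto

text \<open>\<open>hurwitz_triple\<close> splits one pair off the first three entries and leaves a
  tail that is two entries shorter.\<close>

lemma hurwitz_double_tail:
  "xs \<noteq> [] \<Longrightarrow> \<exists>ys zs. hurwitz xs (double ys @ zs) \<and> length zs \<in> {1, 2}"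
proof (induction "length xs" arbitrary: xs rule: less_induct)
  case less
  show ?case
  proof (cases "length xs \<le> 2")
    case True
    then have "length xs \<in> {1, 2}" using less.prems by (cases xs; cases "tl xs") auto
    then show ?thesis by (intro exI[of _ "[]"] exI[of _ xs]) (auto intro: hurwitz_refl)
  next
    case False
    then obtain a b c vs where xs: "xs = [a, b, c] @ vs"
      by (cases xs; cases "tl xs"; cases "tl (tl xs)") auto
    obtain y z where "hurwitz [a, b, c] [y, y, z]" using hurwitz_triple by blast
    then have h: "hurwitz xs ([y, y] @ z # vs)" unfolding xs using hurwitz_append_right by fastforce
    obtain ys zs where ih: "hurwitz (z # vs) (double ys @ zs)" "length zs \<in> {1, 2}"
      using less.hyps[of "z # vs"] xs by auto
    have "hurwitz xs (double (y # ys) @ zs)"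
      using hurwitz_trans[OF h hurwitz_append_left[OF ih(1)]] by simp
    then show ?thesis using ih(2) by blast
  qed
qed

lemma hurwitz_double_rotate: "hurwitz (double (us @ y # vs) @ zs) ([y, y] @ double (us @ vs) @ zs)"
  using hurwitz_sym[OF hurwitz_append_right[OF hurwitz_pair_past_list[of y "double us"], of "double vs @ zs"]]
  by simp

lemma hurwitz_singleton_past_double: "hurwitz (double ys @ z # vs) (z # double ys @ vs)"
proof (induction ys)
  case (Cons y ys)
  have "hurwitz (double (y # ys) @ z # vs) ([y, y] @ z # double ys @ vs)"
    using hurwitz_append_left[OF Cons, of "[y, y]"] by simp
  also have "hurwitz \<dots> (z # double (y # ys) @ vs)"
    using hurwitz_append_right[OF hurwitz_pair_past, of y z "double ys @ vs"] by simp
  finally show ?case .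
qed (simp add: hurwitz_refl)

lemma double_replicate: "double (replicate m 0) = replicate (2 * m) 0"
  by (induction m) auto

text \<open>Reflecting in \<open>z\<close> and then in \<open>x\<close> is the translation by 2(x -
  z).\<close>

lemma hurwitz_pair_translate:
  assumes "x \<in> set zs" "z \<in> set zs"
  shows "hurwitz ([y, y] @ zs) ([y + int k * (2 * (x - z)), y + int k * (2 * (x - z))] @ zs)"
proof (induction k)
  case (Suc k)
  let ?y = "y + int k * (2 * (x - z))"
  have "hurwitz ([?y, ?y] @ zs) ([2 * z - ?y, 2 * z - ?y] @ zs)"
    by (rule hurwitz_pair_reflect_mem[OF assms(2)])
  also have "hurwitz \<dots> ([2 * x - (2 * z - ?y), 2 * x - (2 * z - ?y)] @ zs)"
    by (rule hurwitz_pair_reflect_mem[OF assms(1)])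
  finally show ?case using hurwitz_trans[OF Suc] by (simp add: algebra_simps)
qed (simp add: hurwitz_refl)

text \<open>The anchors 0 and 1 give translations by 2 in both directions, which act transitively on
  the even integers.\<close>

lemma hurwitz_even_pair:
  assumes "0 \<in> set zs" "1 \<in> set zs" "even y"
  shows "hurwitz ([y, y] @ zs) ([0, 0] @ zs)"
proof -
  obtain m where y: "y = 2 * m" using assms(3) by (elim evenE)
  show ?thesis
  proof (cases "m \<ge> 0")
    case True
    then show ?thesis using hurwitz_pair_translate[OF assms(1,2), of y "nat m"] by (simp add: y)
  next
    case False
    then show ?thesis using hurwitz_pair_translate[OF assms(2,1), of y "nat (- m)"] by (simp add: y)
  qed
qed

text \<open>The hypothesis ranges over all \<open>us\<close> because the remaining pairs stand
  between the pair being cleared and the anchor \<open>zs\<close>.\<close>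

lemma hurwitz_double_zero:
  assumes "\<And>y us. y \<in> set ys \<Longrightarrow> hurwitz ([y, y] @ us @ zs) ([0, 0] @ us @ zs)"
  shows "hurwitz (double ys @ zs) (double (replicate (length ys) 0) @ zs)"
  using assms
proof (induction ys)
  case (Cons y ys)
  have "hurwitz (double (y # ys) @ zs) ([0, 0] @ double ys @ zs)"
    using Cons.prems[of y "double ys"] by simp
  also have "hurwitz \<dots> ([0, 0] @ double (replicate (length ys) 0) @ zs)"
    using Cons by (intro hurwitz_append_left) simp
  finally show ?case by simp
qed (simp add: hurwitz_refl)

text \<open>Euclidean algorithm on the numbers y - 1, measured by the sum of their absolute values.
  Evenness keeps every y - 1 away from zero, so a step never stalls at a vanishing partner.\<close>

lemma hurwitz_double_equal_abs:
  assumes "\<forall>y\<in>set ys. even y"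
  shows "\<exists>ys' d. hurwitz (double ys @ [1]) (double ys' @ [1]) \<and> (\<forall>y\<in>set ys'. \<bar>y - 1\<bar> = d)"
  using assms
proof (induction "nat (\<Sum>y\<leftarrow>ys. \<bar>y - 1\<bar>)" arbitrary: ys rule: less_induct)
  case less
  show ?case
  proof (cases "\<exists>y\<in>set ys. \<exists>z\<in>set ys. \<bar>z - 1\<bar> < \<bar>y - 1\<bar>")
    case False
    then have "\<forall>y\<in>set ys. \<bar>y - 1\<bar> = \<bar>hd ys - 1\<bar>"
      by (metis empty_iff hd_in_set linorder_less_linear list.set(1))
    then show ?thesis using hurwitz_refl by blast
  next
    case True
    then obtain y z where y: "y \<in> set ys" and z: "z \<in> set ys" and yz: "\<bar>z - 1\<bar> < \<bar>y - 1\<bar>" by blast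
    obtain us vs where ys: "ys = us @ y # vs" using split_list[OF y] by blast
    \<comment> \<open>The strict inequality forces \<open>z\<close> to differ from \<open>y\<close>,
      so a copy of \<open>z\<close> survives when \<open>y\<close> is taken out.\<close>
    have zm: "z \<in> set (double (us @ vs) @ [1])" using z yz ys by auto
    \<comment> \<open>If y - 1 and z - 1 have opposite signs, reflecting in the entry 1 first
      negates y - 1. With equal signs, reflecting in \<open>z\<close> gives y' - 1 = 2(z - 1) - (y -
      1), which is smaller in absolute value since z - 1 is nonzero and smaller than y - 1.\<close>
    define y' where "y' = (if (z - 1) * (y - 1) > 0 then 2 * z - y else 2 * z - (2 - y))"
    have "hurwitz ([y, y] @ double (us @ vs) @ [1]) ([y', y'] @ double (us @ vs) @ [1])"
    proof (cases "(z - 1) * (y - 1) > 0")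
      case True
      then show ?thesis using hurwitz_pair_reflect_mem[OF zm, of y] by (simp add: y'_def)
    next
      case False
      have "hurwitz ([y, y] @ double (us @ vs) @ [1]) ([2 * 1 - y, 2 * 1 - y] @ double (us @ vs) @ [1])"
        by (rule hurwitz_pair_reflect_mem) simp
      then show ?thesis
        using hurwitz_trans[OF _ hurwitz_pair_reflect_mem[OF zm, of "2 - y"]] False by (simp add: y'_def)
    qed
    then have h: "hurwitz (double ys @ [1]) (double (y' # us @ vs) @ [1])"
      using hurwitz_trans[OF hurwitz_double_rotate[of us y vs "[1]"]] by (simp add: ys)
    have "even z" "even y" using less.prems y z by auto
    then have "even y'" "z \<noteq> 1" by (auto simp: y'_def)
    then have "\<bar>y' - 1\<bar> < \<bar>y - 1\<bar>"
      using yz by (auto simp: y'_def zero_less_mult_iff abs_if split: if_splits)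
    moreover have "(\<Sum>y\<leftarrow>us. \<bar>y - 1\<bar>) \<ge> 0" "(\<Sum>y\<leftarrow>vs. \<bar>y - 1\<bar>) \<ge> 0"
      by (auto intro!: sum_list_nonneg)
    ultimately have "nat (\<Sum>y\<leftarrow>y' # us @ vs. \<bar>y - 1\<bar>) < nat (\<Sum>y\<leftarrow>ys. \<bar>y - 1\<bar>)"
      by (simp add: ys)
    then obtain ys' d where "hurwitz (double (y' # us @ vs) @ [1]) (double ys' @ [1])"
      "\<forall>y\<in>set ys'. \<bar>y - 1\<bar> = d"
      using less.hyps[of "y' # us @ vs"] less.prems \<open>even y'\<close> ys by auto
    then show ?thesis using hurwitz_trans[OF h] by blast
  qed
qed

text \<open>The three hypotheses are invariant under moves, so they can be read off after splitting
  into pairs and a short tail. The divisor condition is guarded by the length because the tuple [1]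
  satisfies its premise for every d.\<close>

theorem hurwitz_canonical:
  assumes "alt_sum xs = 1" "length (filter odd xs) = 1"
    and gcd: "\<And>d. length xs > 1 \<Longrightarrow> \<forall>x\<in>set xs. d dvd x - 1 \<Longrightarrow> d dvd 1"
  shows "hurwitz xs (1 # replicate (length xs - 1) 0)"
proof -
  obtain ys zs where h: "hurwitz xs (double ys @ zs)" and l: "length zs \<in> {1, 2}"
    using hurwitz_double_tail[of xs] assms(1) by (cases xs) auto
  have sum: "alt_sum zs = 1" using hurwitz_alt_sum[OF h] assms(1) by simp
  have "2 * length (filter odd ys) + length (filter odd zs) = 1"
    using hurwitz_odd_count[OF h] assms(2) odd_count_double[of ys zs] by simp
  then have "length (filter odd ys) = 0" by arith
  then have ev: "\<forall>y\<in>set ys. even y" by (auto simp: filter_empty_conv)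
  have len: "length xs = 2 * length ys + length zs" using hurwitz_length[OF h] by simp
  consider p q where "zs = [p, q]" | "zs = [1]"
    using l sum by (auto simp: length_Suc_conv numeral_2_eq_2)
  then show ?thesis
  proof cases
    case 1
    \<comment> \<open>Since the tail has difference 1, it slides to [1, 0], which supplies both
      anchors for clearing the even pairs.\<close>
    then have "p = q + 1" using sum by simp
    then have "hurwitz zs [1, 0]" using 1 hurwitz_shift[of p q "1 - p"] by simp
    then have "hurwitz xs (double ys @ [1, 0])" using hurwitz_trans[OF h hurwitz_append_left] by blast
    also have "hurwitz \<dots> (double (replicate (length ys) 0) @ [1, 0])"
      using ev hurwitz_even_pair by (intro hurwitz_double_zero) simp
    also have "hurwitz \<dots> (1 # double (replicate (length ys) 0) @ [0])"
      by (rule hurwitz_singleton_past_double)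
    finally show ?thesis using 1 len by (simp add: double_replicate replicate_append_same)
  next
    case 2
    obtain ys' d where h1: "hurwitz (double ys @ [1]) (double ys' @ [1])"
      and d: "\<forall>y\<in>set ys'. \<bar>y - 1\<bar> = d"
      using hurwitz_double_equal_abs[OF ev] by blast
    note h2 = hurwitz_trans[OF h[unfolded 2] h1]
    have len': "length xs = Suc (2 * length ys')" using hurwitz_length[OF h2] by simp
    \<comment> \<open>The common absolute value \<open>d\<close> divides every y - 1, and 1 - 1 as
      well, so the divisor condition forces it to be 1.\<close>
    have "y \<in> {0, 2}" if y: "y \<in> set ys'" for y
    proof -
      have "d dvd x - 1" if "x \<in> set ys'" for x using d that by (metis abs_dvd_iff dvd_refl)
      then have "\<forall>x\<in>set (double ys' @ [1]). d dvd x - 1" by auto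
      then have "\<forall>x\<in>set xs. d dvd x - 1" using hurwitz_dvd[OF h2] by blast
      moreover have "length xs > 1" using len' y by (cases ys') auto
      ultimately have "d dvd 1" using gcd by blast
      moreover have "\<bar>y - 1\<bar> = d" using d y by blast
      ultimately have "\<bar>y - 1\<bar> = 1" by auto
      then show ?thesis by auto
    qed
    then have "hurwitz ([y, y] @ us @ [1]) ([0, 0] @ us @ [1])" if "y \<in> set ys'" for y us
    proof (cases "y = 0")
      case False
      then have "y = 2" using that \<open>\<And>y. y \<in> set ys' \<Longrightarrow> y \<in> {0, 2}\<close> by blast
      then show ?thesis using hurwitz_pair_reflect_mem[of 1 "us @ [1]" y] by simp
    qed (simp add: hurwitz_refl)
    then have "hurwitz (double ys' @ [1]) (double (replicate (length ys') 0) @ [1])"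
      by (rule hurwitz_double_zero)
    also have "hurwitz \<dots> (1 # double (replicate (length ys') 0))"
      using hurwitz_singleton_past_double[of "replicate (length ys') 0" 1 "[]"] by simp
    finally have "hurwitz xs (1 # double (replicate (length ys') 0))" by (rule hurwitz_trans[OF h2])
    then show ?thesis using len' by (simp add: double_replicate)
  qed
qed


section \<open>The Burau image and permutation matrices mod 2\<close>

abbreviation burau_image :: "nat \<Rightarrow> int mat set" where
  "burau_image n \<equiv> burau n ` carrier (braid_group n)"

lemma subgroup_burau_image: "subgroup (burau_image n) (Gamma n)"
proof -
  interpret group_hom "braid_group n" "Gamma n" "burau n"
    by (simp add: group_hom_def group_hom_axioms_def group_braid_group group_Gamma burau_Gamma)
  show ?thesis by (rule img_is_subgroup)
qed

lemma burau_image_Gamma: "A \<in> burau_image n \<Longrightarrow> A \<in> carrier (Gamma n)"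
  using subgroup.subset[OF subgroup_burau_image] by blast

lemma burau_image_mult: "A \<in> burau_image n \<Longrightarrow> B \<in> burau_image n \<Longrightarrow> A * B \<in> burau_image n"
  using subgroup.m_closed[OF subgroup_burau_image] by fastforce

lemma burau_image_one: "1\<^sub>m n \<in> burau_image n"
  using subgroup.one_closed[OF subgroup_burau_image, of n] by simp

lemma burau_image_eq_words: "burau_image n = burau_word n ` braid_words n"
proof
  show "burau_image n \<subseteq> burau_word n ` braid_words n"
    by (auto elim!: braid_carrierE simp: burau_class)
  show "burau_word n ` braid_words n \<subseteq> burau_image n"
    using burau_class braid_class_carrier by (metis image_eqI image_subsetI)
qed

lemma burau_gen_image:
  assumes "i + 1 < n"
  shows "burau_gen n i \<in> burau_image n"
proof -
  have "i < n - 1" using assms by simp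
  then show ?thesis
    using burau_artin_gen[of i n] braid_class_carrier[of "[(i, True)]" n]
    by (metis artin_gen_def braid_words_simps(1,2) fst_conv image_eqI)
qed

lemma Gamma_inverse:
  assumes "A \<in> carrier (Gamma n)"
  obtains B where "B \<in> carrier (Gamma n)" "A * B = 1\<^sub>m n" "B * A = 1\<^sub>m n"
  using group.inv_closed[OF group_Gamma assms] group.r_inv[OF group_Gamma assms]
    group.l_inv[OF group_Gamma assms] by simp

lemma burau_image_inverse:
  assumes "A \<in> burau_image n"
  obtains B where "B \<in> burau_image n" "A * B = 1\<^sub>m n" "B * A = 1\<^sub>m n"
  using subgroup.m_inv_closed[OF subgroup_burau_image assms]
    group.r_inv[OF group_Gamma burau_image_Gamma[OF assms]]
    group.l_inv[OF group_Gamma burau_image_Gamma[OF assms]] by simp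

lemma Gamma_mult: "A \<in> carrier (Gamma n) \<Longrightarrow> B \<in> carrier (Gamma n) \<Longrightarrow> A * B \<in> carrier (Gamma n)"
  using monoid.m_closed[OF group.is_monoid[OF group_Gamma], of A n B] by simp

lemma mult_one_mat_vec:
  fixes v :: "int vec"
  assumes "A \<in> carrier_mat n n" "B \<in> carrier_mat n n" "A * B = 1\<^sub>m n" "v \<in> carrier_vec n"
  shows "A *\<^sub>v (B *\<^sub>v v) = v"
  using assms by (simp flip: assoc_mult_mat_vec[of _ n n _ n])

section \<open>Realising Hurwitz moves by Burau matrices\<close>

lemma burau_gen_vec_of_list:
  "burau_gen (length (us @ [a, b] @ vs)) (length us) *\<^sub>v vec_of_list (us @ [a, b] @ vs)
    = vec_of_list (us @ [2 * a - b, a] @ vs)"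
  by (subst burau_gen_action)
    (auto simp: vec_of_list_index nth_append nth_Cons' carrier_vecI intro!: eq_vecI)

lemma burau_gen_fixes_unit_vec:
  assumes "i + 1 < n" "j < i"
  shows "burau_gen n i *\<^sub>v unit_vec n j = unit_vec n j"
  using assms by (subst burau_gen_action) (auto intro!: eq_vecI)

text \<open>A move behind the prefix \<open>us\<close> uses a generator with index at least
  \<open>length us\<close>, and such a generator fixes the earlier basis vectors. Reversed moves are
  realised by inverses in the image.\<close>

lemma hurwitz_burau:
  assumes "hurwitz xs ys" "n = length us + length xs"
  shows "\<exists>B\<in>burau_image n. B *\<^sub>v vec_of_list (us @ xs) = vec_of_list (us @ ys)
    \<and> (\<forall>i<length us. B *\<^sub>v unit_vec n i = unit_vec n i)"
  using assms
proof (induction rule: hurwitz.induct)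
  case (hurwitz_refl xs)
  have "vec_of_list (us @ xs) \<in> carrier_vec n" using hurwitz_refl by (auto intro: carrier_vecI)
  then show ?case using burau_image_one by (intro bexI[of _ "1\<^sub>m n"]) auto
next
  case (hurwitz_sym xs ys)
  then obtain B where B: "B \<in> burau_image n" "B *\<^sub>v vec_of_list (us @ xs) = vec_of_list (us @ ys)"
    "\<forall>i<length us. B *\<^sub>v unit_vec n i = unit_vec n i" using hurwitz_length by metis
  obtain C where C: "C \<in> burau_image n" "C * B = 1\<^sub>m n" using burau_image_inverse[OF B(1)] by blast
  have *: "C *\<^sub>v (B *\<^sub>v v) = v" if "v \<in> carrier_vec n" for v
    using mult_one_mat_vec[of C n B v] B(1) C that Gamma_mat[OF burau_image_Gamma] by simp
  have "vec_of_list (us @ xs) \<in> carrier_vec n"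
    using hurwitz_sym hurwitz_length by (auto intro!: carrier_vecI)
  moreover have "C *\<^sub>v unit_vec n i = unit_vec n i" if "i < length us" for i
    using *[of "unit_vec n i"] B(3) that by simp
  moreover have "C *\<^sub>v vec_of_list (us @ ys) = vec_of_list (us @ xs)"
    using calculation(1) *[of "vec_of_list (us @ xs)"] B(2) by simp
  ultimately show ?case using C(1) by blast
next
  case (hurwitz_trans xs ys zs)
  then obtain B where B: "B \<in> burau_image n" "B *\<^sub>v vec_of_list (us @ xs) = vec_of_list (us @ ys)"
    "\<forall>i<length us. B *\<^sub>v unit_vec n i = unit_vec n i" by metis
  obtain C where C: "C \<in> burau_image n" "C *\<^sub>v vec_of_list (us @ ys) = vec_of_list (us @ zs)"
    "\<forall>i<length us. C *\<^sub>v unit_vec n i = unit_vec n i"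
    using hurwitz_trans hurwitz_length by metis
  have *: "C * B *\<^sub>v v = C *\<^sub>v (B *\<^sub>v v)" if "v \<in> carrier_vec n" for v
    using assoc_mult_mat_vec[of C n n B n v] B(1) C(1) that Gamma_mat[OF burau_image_Gamma] by simp
  have "vec_of_list (us @ xs) \<in> carrier_vec n"
    using hurwitz_trans by (auto intro!: carrier_vecI)
  then have "C * B *\<^sub>v vec_of_list (us @ xs) = vec_of_list (us @ zs)" using * B(2) C(2) by simp
  moreover have "C * B *\<^sub>v unit_vec n i = unit_vec n i" if "i < length us" for i
    using *[of "unit_vec n i"] B(3) C(3) that by simp
  ultimately show ?case using burau_image_mult[OF C(1) B(1)] by blast
next
  case (hurwitz_move ps a b qs)
  let ?i = "length (us @ ps)"
  have n: "n = length ((us @ ps) @ [a, b] @ qs)" and i: "?i + 1 < n" using hurwitz_move by simp_all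
  have "burau_gen n ?i *\<^sub>v vec_of_list (us @ ps @ [a, b] @ qs) = vec_of_list (us @ ps @ [2 * a - b, a] @ qs)"
    using burau_gen_vec_of_list[of "us @ ps" a b qs] by (simp add: n)
  moreover have "burau_gen n ?i *\<^sub>v unit_vec n j = unit_vec n j" if "j < length us" for j
    using that i by (intro burau_gen_fixes_unit_vec) auto
  ultimately show ?case using burau_gen_image[OF i] by blast
qed

text \<open>
  Matrix indices start at 0, whereas \<open>\<pi>\<close> acts on \<^term>\<open>{1..n::nat}\<close>.
\<close>

definition mod2_perm :: "nat \<Rightarrow> (nat \<Rightarrow> nat) \<Rightarrow> int mat \<Rightarrow> bool" where
  "mod2_perm n \<pi> A \<longleftrightarrow> (\<forall>i<n. \<forall>j<n. odd (A $$ (i, j)) \<longleftrightarrow> Suc i = \<pi> (Suc j))"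

text \<open>The odd entry of a column sits in the row named by the permutation, so products match
  composition in the same order: of the summands of an entry, only the one at the odd position in
  the column of \<open>B\<close> can be odd.\<close>

lemma mod2_perm_mult:
  assumes A: "A \<in> carrier_mat n n" "mod2_perm n \<pi> A"
    and B: "B \<in> carrier_mat n n" "mod2_perm n \<tau> B" and \<tau>: "\<tau> \<in> {1..n} \<rightarrow> {1..n}"
  shows "mod2_perm n (\<pi> \<circ> \<tau>) (A * B)"
  unfolding mod2_perm_def
proof (intro allI impI)
  fix i j assume ij: "i < n" "j < n"
  have "\<tau> (Suc j) \<in> {1..n}" using \<tau> ij by auto
  then obtain m where m: "\<tau> (Suc j) = Suc m" "m < n" by (cases "\<tau> (Suc j)") auto
  have "(A * B) $$ (i, j) = (\<Sum>k<n. A $$ (i, k) * B $$ (k, j))"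
    using A B ij by (simp add: scalar_prod_def lessThan_atLeast0)
  also have "\<dots> = A $$ (i, m) * B $$ (m, j) + (\<Sum>k\<in>{..<n} - {m}. A $$ (i, k) * B $$ (k, j))"
    using m by (intro sum.remove) auto
  finally have "odd ((A * B) $$ (i, j)) \<longleftrightarrow>
      odd (A $$ (i, m) * B $$ (m, j) + (\<Sum>k\<in>{..<n} - {m}. A $$ (i, k) * B $$ (k, j)))" by simp
  moreover have "even (\<Sum>k\<in>{..<n} - {m}. A $$ (i, k) * B $$ (k, j))"
    using B m ij by (intro dvd_sum) (auto simp: mod2_perm_def)
  moreover have "odd (B $$ (m, j))" using B(2) m ij by (auto simp: mod2_perm_def)
  ultimately show "odd ((A * B) $$ (i, j)) \<longleftrightarrow> Suc i = (\<pi> \<circ> \<tau>) (Suc j)"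
    using A(2) m ij by (simp add: mod2_perm_def)
qed

lemma mod2_perm_one: "mod2_perm n id (1\<^sub>m n)"
  by (auto simp: mod2_perm_def)

lemma mod2_perm_burau_gen: "mod2_perm n (Transposition.transpose (i + 1) (i + 2)) (burau_gen n i)"
  by (auto simp: mod2_perm_def burau_gen_def Transposition.transpose_def)

text \<open>Row \<open>\<pi> (Suc m)\<close> of \<open>A\<close> is odd only in column m, so modulo
  2 that row of \<open>A * B\<close> is just row m of \<open>B\<close>; comparison with the identity
  matrix gives the pattern.\<close>

lemma mod2_perm_inverse:
  assumes A: "A \<in> carrier_mat n n" "mod2_perm n \<pi> A" and \<pi>: "\<pi> permutes {1..n}"
    and B: "B \<in> carrier_mat n n" and AB: "A * B = 1\<^sub>m n"
  shows "mod2_perm n (inv_into UNIV \<pi>) B"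
  unfolding mod2_perm_def
proof (intro allI impI)
  fix m j assume mj: "m < n" "j < n"
  have "\<pi> (Suc m) \<in> {1..n}" using permutes_in_image[OF \<pi>] mj by auto
  then obtain i where i: "\<pi> (Suc m) = Suc i" "i < n" by (cases "\<pi> (Suc m)") auto
  have odd_iff: "odd (A $$ (i, k)) \<longleftrightarrow> k = m" if "k < n" for k
    using A(2) i that permutes_inj[OF \<pi>] by (auto simp: mod2_perm_def dest: injD)
  have "(A * B) $$ (i, j) = (\<Sum>k<n. A $$ (i, k) * B $$ (k, j))"
    using A B i mj by (simp add: scalar_prod_def lessThan_atLeast0)
  also have "\<dots> = A $$ (i, m) * B $$ (m, j) + (\<Sum>k\<in>{..<n} - {m}. A $$ (i, k) * B $$ (k, j))"
    using mj by (intro sum.remove) auto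
  finally have "odd ((A * B) $$ (i, j)) \<longleftrightarrow>
      odd (A $$ (i, m) * B $$ (m, j) + (\<Sum>k\<in>{..<n} - {m}. A $$ (i, k) * B $$ (k, j)))" by simp
  moreover have "even (\<Sum>k\<in>{..<n} - {m}. A $$ (i, k) * B $$ (k, j))"
    using odd_iff by (intro dvd_sum) auto
  moreover have "odd ((A * B) $$ (i, j)) \<longleftrightarrow> i = j" using i mj AB by simp
  ultimately have "odd (B $$ (m, j)) \<longleftrightarrow> i = j" using odd_iff[OF mj(1)] by simp
  also have "\<dots> \<longleftrightarrow> Suc m = inv_into UNIV \<pi> (Suc j)"
    using i permutes_inv_eq[OF \<pi>, of "Suc j" "Suc m"] by auto
  finally show "odd (B $$ (m, j)) \<longleftrightarrow> Suc m = inv_into UNIV \<pi> (Suc j)" .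
qed

lemma burau_letter_mod2_perm:
  assumes "fst l < n - 1"
  shows "\<exists>\<sigma>. \<sigma> permutes {1..n} \<and> mod2_perm n \<sigma> (burau_letter n l)"
proof -
  obtain i e where l: "l = (i, e)" by (cases l)
  let ?\<tau> = "Transposition.transpose (i + 1) (i + 2)"
  have i: "i + 1 < n" using assms l by simp
  have \<tau>: "?\<tau> permutes {1..n}" using i by (intro permutes_swap_id) auto
  show ?thesis
  proof (cases e)
    case True
    then show ?thesis using \<tau> mod2_perm_burau_gen[of n i] by (auto simp: l burau_letter_def)
  next
    case False
    have "mod2_perm n (inv_into UNIV ?\<tau>) (inv\<^bsub>GL_int n\<^esub> burau_gen n i)"
      using mod2_perm_burau_gen[of n i] \<tau> burau_gen_GL[OF i]
        GL_int_mat[OF group.inv_closed[OF group_GL_int]] group.r_inv[OF group_GL_int, of _ n]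
      by (intro mod2_perm_inverse[of "burau_gen n i"]) auto
    then show ?thesis using False permutes_inv[OF \<tau>] by (auto simp: l burau_letter_def)
  qed
qed

lemma burau_image_mod2_perm:
  assumes "B \<in> burau_image n"
  shows "\<exists>\<sigma>. \<sigma> permutes {1..n} \<and> mod2_perm n \<sigma> B"
proof -
  have "\<exists>\<sigma>. \<sigma> permutes {1..n} \<and> mod2_perm n \<sigma> (burau_word n w)" if "w \<in> braid_words n" for w
    using that
  proof (induction w)
    case Nil
    show ?case using mod2_perm_one[of n] permutes_id[of "{1..n}"] burau_word_simps(1)[of n] by metis
  next
    case (Cons l w)
    then obtain \<tau> where \<tau>: "\<tau> permutes {1..n}" "mod2_perm n \<tau> (burau_word n w)" by auto
    obtain \<sigma> where \<sigma>: "\<sigma> permutes {1..n}" "mod2_perm n \<sigma> (burau_letter n l)"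
      using burau_letter_mod2_perm[of l n] Cons.prems by auto
    have "mod2_perm n (\<sigma> \<circ> \<tau>) (burau_letter n l * burau_word n w)"
      using \<sigma> \<tau> Cons.prems GL_int_mat[OF burau_letter_GL] GL_int_mat[OF burau_word_GL]
      by (intro mod2_perm_mult) (auto dest: permutes_in_image)
    then show ?case using permutes_compose[OF \<tau>(1) \<sigma>(1)] by auto
  qed
  then show ?thesis using assms by (auto simp: burau_image_eq_words)
qed

section \<open>Coordinates and columns of elements of Gamma\<close>

lemma Gamma_preserves:
  assumes "A \<in> carrier (Gamma n)"
  shows "\<And>v w. v \<in> carrier_vec n \<Longrightarrow> w \<in> carrier_vec n \<Longrightarrow> form n (A *\<^sub>v v) (A *\<^sub>v w) = form n v w"
    and "A *\<^sub>v v_vec n = v_vec n"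
    and "transpose_mat A *\<^sub>v w_vec n = w_vec n"
  using assms by (simp_all add: Gamma_def)

lemma w_vec_carrier [simp]: "w_vec n \<in> carrier_vec n"
  by (simp add: w_vec_def)

lemma v_vec_carrier [simp]: "v_vec n \<in> carrier_vec n"
  by (simp add: v_vec_def)

lemma Gamma_w_vec:
  assumes "A \<in> carrier (Gamma n)" "x \<in> carrier_vec n"
  shows "w_vec n \<bullet> (A *\<^sub>v x) = w_vec n \<bullet> x"
  using transpose_vec_mult_scalar[OF Gamma_mat[OF assms(1)] assms(2), of "w_vec n"]
    Gamma_preserves(3)[OF assms(1)] by simp

lemma w_vec_scalar_prod: "x \<in> carrier_vec n \<Longrightarrow> w_vec n \<bullet> x = (\<Sum>i<n. (-1) ^ i * x $ i)"
  by (simp add: w_vec_def scalar_prod_def lessThan_atLeast0)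

lemma form_unit_vec:
  assumes "i < n"
  shows "form n (unit_vec n i) x = (\<Sum>j<n. x $ j * form_coeff i j)"
proof -
  have "form n (unit_vec n i) x = (\<Sum>r<n. if r = i then (\<Sum>j<n. x $ j * form_coeff i j) else 0)"
    unfolding form_def using assms by (intro sum.cong) auto
  then show ?thesis using assms by simp
qed

text \<open>The coefficients of the form and of (-1)^i w_n cancel to the right of position i, add up
  to 1 at i and double to its left.\<close>

lemma coord_eq_form:
  assumes "i < n" "x \<in> carrier_vec n"
  shows "x $ i = form n (unit_vec n i) x + (-1) ^ i * (w_vec n \<bullet> x) - 2 * (\<Sum>j<i. (-1) ^ (i + j) * x $ j)"
proof -
  have "form n (unit_vec n i) x + (-1) ^ i * (w_vec n \<bullet> x)
      = (\<Sum>j<n. x $ j * (form_coeff i j + (-1) ^ (i + j)))"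
    using assms by (simp add: form_unit_vec w_vec_scalar_prod sum_distrib_left algebra_simps power_add
        flip: sum.distrib)
  also have "\<dots> = (\<Sum>j<n. (if j = i then x $ j else 0) + (if j < i then 2 * ((-1) ^ (i + j) * x $ j) else 0))"
    by (intro sum.cong) (auto simp: form_coeff_def)
  also have "\<dots> = x $ i + (\<Sum>j<n. if j < i then 2 * ((-1) ^ (i + j) * x $ j) else 0)"
    using assms(1) by (subst sum.distrib) simp
  also have "(\<Sum>j<n. if j < i then 2 * ((-1) ^ (i + j) * x $ j) else 0) = (\<Sum>j<i. 2 * ((-1) ^ (i + j) * x $ j))"
    using assms(1) by (intro sum.mono_neutral_cong_right) auto
  also have "\<dots> = 2 * (\<Sum>j<i. (-1) ^ (i + j) * x $ j)" by (rule sum_distrib_left[symmetric])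
  finally show ?thesis by simp
qed

text \<open>Pairing with a fixed basis vector and with w_n is preserved, and
  \<open>coord_eq_form\<close> expresses a coordinate through these two and the earlier coordinates,
  so the claim propagates upwards.\<close>

lemma Gamma_fixes_coords:
  assumes A: "A \<in> carrier (Gamma n)" and fixed: "\<forall>i<k. A *\<^sub>v unit_vec n i = unit_vec n i"
    and x: "x \<in> carrier_vec n" and "k \<le> n" "i < k"
  shows "(A *\<^sub>v x) $ i = x $ i"
  using \<open>i < k\<close>
proof (induction i rule: less_induct)
  case (less i)
  have i: "i < n" using less.prems assms(4) by simp
  have Ax: "A *\<^sub>v x \<in> carrier_vec n" using Gamma_mat[OF A] x by auto
  have "form n (unit_vec n i) (A *\<^sub>v x) = form n (A *\<^sub>v unit_vec n i) (A *\<^sub>v x)"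
    using fixed less.prems by simp
  also have "\<dots> = form n (unit_vec n i) x" using Gamma_preserves(1)[OF A _ x] by simp
  finally have f: "form n (unit_vec n i) (A *\<^sub>v x) = form n (unit_vec n i) x" .
  have "(\<Sum>j<i. (-1) ^ (i + j) * (A *\<^sub>v x) $ j) = (\<Sum>j<i. (-1) ^ (i + j) * x $ j)"
    using less by (intro sum.cong) auto
  then show ?case
    unfolding coord_eq_form[OF i Ax] coord_eq_form[OF i x] f Gamma_w_vec[OF A x] by simp
qed

lemma mult_unit_vec_index:
  fixes A :: "int mat"
  assumes "A \<in> carrier_mat n n" "i < n" "j < n"
  shows "(A *\<^sub>v unit_vec n j) $ i = A $$ (i, j)"
  using assms by simp

lemma mult_mat_vec_index:
  assumes "A \<in> carrier_mat n n" "x \<in> carrier_vec n" "i < n"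
  shows "(A *\<^sub>v x) $ i = (\<Sum>j<n. A $$ (i, j) * x $ j)"
  using assms by (simp add: scalar_prod_def lessThan_atLeast0)

lemma alt_sum_eq_w_vec: "alt_sum xs = w_vec (length xs) \<bullet> vec_of_list xs"
proof -
  have "alt_sum xs = (\<Sum>i<length xs. (-1) ^ i * xs ! i)"
    by (induction xs) (simp_all add: sum.lessThan_Suc_shift sum_negf del: sum.lessThan_Suc)
  then show ?thesis
    by (simp add: w_vec_scalar_prod carrier_vecI vec_of_list_index)
qed

text \<open>
  Let \<open>q\<close> be the fixed vector \<open>v\<^sub>n - e\<^sub>1 - \<dots> - e\<^sub>k\<close>. A common divisor of the entries of
  \<open>A e - q\<close>, for a basis vector \<open>e\<close>, also divides those of \<open>e - q\<close>, one of which is \<open>-1\<close>.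
\<close>

lemma Gamma_column_differences:
  assumes A: "A \<in> carrier (Gamma n)" and fixed: "\<forall>i<k. A *\<^sub>v unit_vec n i = unit_vec n i"
    and c: "k \<le> c" "c < n" and r: "k \<le> r" "r < n" "r \<noteq> c"
    and d: "\<And>i. k \<le> i \<Longrightarrow> i < n \<Longrightarrow> d dvd A $$ (i, c) - 1"
  shows "d dvd (1::int)"
proof -
  note Am = Gamma_mat[OF A]
  obtain C where C: "C \<in> carrier (Gamma n)" "C * A = 1\<^sub>m n" using Gamma_inverse[OF A] by blast
  note Cm = Gamma_mat[OF C(1)]
  define q :: "int vec" where "q = vec n (\<lambda>i. if i < k then 0 else 1)"
  have q: "q \<in> carrier_vec n" by (simp add: q_def)
  define y where "y = A *\<^sub>v unit_vec n c - q"
  have y: "y \<in> carrier_vec n" using Am q by (auto simp: y_def)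
  have Aq: "A *\<^sub>v q = q"
  proof (rule eq_vecI)
    fix i assume "i < dim_vec q"
    then have i: "i < n" by (simp add: q_def)
    have fix_entry: "A $$ (i, j) = (if i = j then 1 else 0)" if "j < k" for j
      using mult_unit_vec_index[OF Am i, of j] fixed that c i by simp
    have "(A *\<^sub>v q) $ i = (\<Sum>j<n. A $$ (i, j) * v_vec n $ j - (if j = i then if i < k then 1 else 0 else 0))"
      unfolding mult_mat_vec_index[OF Am q i]
      by (intro sum.cong) (auto simp: q_def v_vec_def fix_entry)
    also have "\<dots> = (A *\<^sub>v v_vec n) $ i - (if i < k then 1 else 0)"
      using i by (simp only: mult_mat_vec_index[OF Am v_vec_carrier i] sum_subtractf) simp
    also have "\<dots> = q $ i" using i Gamma_preserves(2)[OF A] by (simp add: q_def v_vec_def)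
    finally show "(A *\<^sub>v q) $ i = q $ i" .
  qed (use Am in \<open>simp add: q_def\<close>)
  have Cu: "C *\<^sub>v (A *\<^sub>v v) = v" if "v \<in> carrier_vec n" for v
    using mult_one_mat_vec[OF Cm Am C(2) that] .
  have "C *\<^sub>v y = C *\<^sub>v (A *\<^sub>v unit_vec n c) - C *\<^sub>v (A *\<^sub>v q)"
    unfolding y_def Aq using Am Cm q by (intro mult_minus_distrib_mat_vec) auto
  then have "(C *\<^sub>v y) $ (r) = -1" using c r q by (simp add: Cu q_def)
  moreover have "(C *\<^sub>v y) $ (r) = (\<Sum>j<n. C $$ (r, j) * y $ j)"
    by (rule mult_mat_vec_index[OF Cm y r(2)])
  moreover have "d dvd (\<Sum>j<n. C $$ (r, j) * y $ j)"
  proof (intro dvd_sum dvd_mult)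
    fix j assume "j \<in> {..<n}"
    then have j: "j < n" by simp
    \<comment> \<open>Below \<open>k\<close> the entry is zero: both \<open>q\<close> and the unit
      vector at \<open>c\<close> vanish there, and \<open>A\<close> preserves these
      coordinates.\<close>
    show "d dvd y $ j"
    proof (cases "j < k")
      case True
      then show ?thesis
        using j c Gamma_fixes_coords[OF A fixed, of "unit_vec n c" j] Am by (simp add: y_def q_def)
    next
      case False
      then show ?thesis using j c d[of j] Am by (simp add: y_def q_def)
    qed
  qed
  ultimately have "d dvd -1" by metis
  then show ?thesis by simp
qed

text \<open>Induction on the number of basis vectors not yet fixed. It is stated for a self-map
  \<open>\<pi>\<close> rather than a permutation, because a mere parity count in each column yields
  a self-map.\<close>

lemma Gamma_mod2_perm_fixing_image:
  assumes "A \<in> carrier (Gamma n)" "mod2_perm n \<pi> A" "\<pi> \<in> {1..n} \<rightarrow> {1..n}"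
    "k \<le> n" "\<forall>i<k. A *\<^sub>v unit_vec n i = unit_vec n i"
  shows "A \<in> burau_image n"
  using assms
proof (induction "n - k" arbitrary: k A \<pi>)
  case 0
  note Am = Gamma_mat[OF 0(2)]
  have "A = 1\<^sub>m n"
  proof (rule eq_matI)
    fix i j assume "i < dim_row (1\<^sub>m n)" "j < dim_col (1\<^sub>m n)"
    then show "A $$ (i, j) = 1\<^sub>m n $$ (i, j)"
      using mult_unit_vec_index[OF Am, of i j] 0 by simp
  qed (use Am in auto)
  then show ?case using burau_image_one by simp
next
  case (Suc m)
  note A = Suc.prems(1) and \<pi> = Suc.prems(2,3) and fixed = Suc.prems(5)
  note Am = Gamma_mat[OF A]
  have k: "k < n" using Suc.hyps(2) by simp
  define xs where "xs = map (\<lambda>i. A $$ (i, k)) [k..<n]"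
  define us where "us = replicate k (0::int)"
  have len: "length us = k" "length xs = n - k" by (simp_all add: xs_def us_def)
  have n: "n = length us + length xs" using k by (simp add: len)
  have A_upper: "A $$ (i, k) = 0" if "i < k" for i
    using Gamma_fixes_coords[OF A fixed, of "unit_vec n k" i] that k Am by simp
  have list: "us @ xs = map (\<lambda>i. A $$ (i, k)) [0..<n]"
    using A_upper k by (intro nth_equalityI) (auto simp: us_def xs_def nth_append)
  have x: "vec_of_list (us @ xs) = A *\<^sub>v unit_vec n k"
    using Am k by (intro eq_vecI) (auto simp: vec_of_list_index list)
  have "alt_sum (us @ xs) = w_vec n \<bullet> (A *\<^sub>v unit_vec n k)"
    unfolding alt_sum_eq_w_vec x using k by (simp add: len)
  also have "\<dots> = (-1) ^ k" using k by (simp add: Gamma_w_vec[OF A]) (simp add: w_vec_def)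
  \<comment> \<open>The \<open>k\<close> leading zeros shift the signs of \<open>xs\<close> by
    (-1)^k, the same sign that w_n has at position \<open>k\<close>.\<close>
  finally have "alt_sum us + (-1) ^ k * alt_sum xs = (-1) ^ k" by (simp add: alt_sum_append len)
  moreover have "alt_sum us = 0" unfolding us_def by (induction k) auto
  ultimately have alt: "alt_sum xs = 1" by simp
  have "\<pi> (Suc k) \<in> {1..n}" using \<pi> k by auto
  then obtain m where m: "\<pi> (Suc k) = Suc m" "m < n" by (cases "\<pi> (Suc k)") auto
  have "length (filter odd (us @ xs)) = length (filter (\<lambda>i. odd (A $$ (i, k))) [0..<n])"
    unfolding list by (simp add: filter_map o_def)
  also have "\<dots> = length (filter (\<lambda>i. i = m) [0..<n])"
    using \<pi>(1) k m by (intro arg_cong[of _ _ length] filter_cong) (auto simp: mod2_perm_def)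
  also have "\<dots> = card ({i. i = m} \<inter> set [0..<n])" by (rule distinct_length_filter) simp
  also have "{i. i = m} \<inter> set [0..<n] = {m}" using m by auto
  finally have odd: "length (filter odd xs) = 1" by (simp add: us_def)
  \<comment> \<open>The comparison row is k + 1, which exists because \<open>xs\<close> has at least
    two entries.\<close>
  have gcd: "d dvd 1" if "length xs > 1" "\<forall>x\<in>set xs. d dvd x - 1" for d
    using that k by (intro Gamma_column_differences[OF A fixed, of k "Suc k"]) (auto simp: xs_def)
  obtain B where B: "B \<in> burau_image n"
      "B *\<^sub>v vec_of_list (us @ xs) = vec_of_list (us @ 1 # replicate (length xs - 1) 0)"
      "\<forall>i<k. B *\<^sub>v unit_vec n i = unit_vec n i"
    using hurwitz_burau[OF hurwitz_canonical[OF alt odd gcd] n] unfolding len(1) by blast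
  note BG = burau_image_Gamma[OF B(1)]
  note Bm = Gamma_mat[OF BG]
  have BA: "B * A *\<^sub>v v = B *\<^sub>v (A *\<^sub>v v)" if "v \<in> carrier_vec n" for v
    using assoc_mult_mat_vec[OF Bm Am that] .
  have "vec_of_list (us @ 1 # replicate (length xs - 1) 0) = unit_vec n k"
    using k len by (intro eq_vecI) (auto simp: vec_of_list_index nth_append nth_Cons' us_def)
  then have "B * A *\<^sub>v unit_vec n k = unit_vec n k" using B(2) BA x by simp
  then have fixed': "\<forall>i<Suc k. B * A *\<^sub>v unit_vec n i = unit_vec n i"
    using B(3) fixed BA by (auto simp: less_Suc_eq)
  \<comment> \<open>\<open>B\<close> is itself a permutation matrix mod 2, so the parity hypothesis
    passes to \<open>B * A\<close>.\<close>
  obtain \<sigma> where \<sigma>: "\<sigma> permutes {1..n}" "mod2_perm n \<sigma> B" using burau_image_mod2_perm[OF B(1)] by blast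
  have "\<sigma> \<circ> \<pi> \<in> {1..n} \<rightarrow> {1..n}" using \<pi>(2) permutes_in_image[OF \<sigma>(1)] by fastforce
  then have BA_image: "B * A \<in> burau_image n"
    using Suc.hyps(2) k fixed' mod2_perm_mult[OF Bm \<sigma>(2) Am \<pi>] Gamma_mult[OF BG A]
    by (intro Suc.hyps(1)[of "Suc k" "B * A" "\<sigma> \<circ> \<pi>"]) auto
  obtain C where C: "C \<in> burau_image n" "C * B = 1\<^sub>m n" using burau_image_inverse[OF B(1)] by blast
  have "C * (B * A) = C * B * A"
    using assoc_mult_mat[OF Gamma_mat[OF burau_image_Gamma[OF C(1)]] Bm Am] by simp
  then show ?case using burau_image_mult[OF C(1) BA_image] C(2) Am by simp
qed

theorem Gamma_mod2_perm_image:
  assumes "A \<in> carrier (Gamma n)" "mod2_perm n \<pi> A" "\<pi> \<in> {1..n} \<rightarrow> {1..n}"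
  shows "A \<in> burau_image n"
  using Gamma_mod2_perm_fixing_image[OF assms, of 0] by simp


section \<open>The symmetric group in the quotient\<close>

text \<open>Conjugating the transposition of a and b by the adjacent transposition of b and b + 1
  raises the larger point by one.\<close>

lemma burau_image_realizes_transpose:
  assumes "a < b" "1 \<le> a" "b \<le> n"
  shows "\<exists>A\<in>burau_image n. mod2_perm n (Transposition.transpose a b) A"
  using assms
proof (induction b)
  case (Suc b)
  have adj: "\<exists>A\<in>burau_image n. mod2_perm n (Transposition.transpose c (Suc c)) A" if "1 \<le> c" "Suc c \<le> n" for c
    using that mod2_perm_burau_gen[of n "c - 1"] burau_gen_image[of "c - 1" n] by auto
  show ?case
  proof (cases "a = b")
    case True
    then show ?thesis using adj[of b] Suc.prems by simp
  next
    case False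
    let ?s = "Transposition.transpose b (Suc b)" and ?t = "Transposition.transpose a b"
    obtain A where A: "A \<in> burau_image n" "mod2_perm n ?t A" using Suc False by auto
    obtain S where S: "S \<in> burau_image n" "mod2_perm n ?s S" using adj[of b] Suc.prems by auto
    have m: "A \<in> carrier_mat n n" "S \<in> carrier_mat n n" using A S Gamma_mat burau_image_Gamma by blast+
    have maps: "?s \<in> {1..n} \<rightarrow> {1..n}" "?t \<in> {1..n} \<rightarrow> {1..n}"
      using Suc.prems by (auto simp: Transposition.transpose_def)
    have "mod2_perm n (?s \<circ> (?t \<circ> ?s)) (S * (A * S))"
      using m A S maps by (intro mod2_perm_mult) (auto intro: mult_carrier_mat[of _ n n _ n] simp: Pi_iff)
    moreover have "?s \<circ> (?t \<circ> ?s) = Transposition.transpose a (Suc b)"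
      using Suc.prems False by (auto simp: fun_eq_iff Transposition.transpose_def)
    ultimately show ?thesis using A S burau_image_mult by metis
  qed
qed simp

lemma burau_image_realizes_perm:
  assumes "\<pi> permutes {1..n}"
  shows "\<exists>A\<in>burau_image n. mod2_perm n \<pi> A"
  using assms finite_atLeastAtMost
proof (induction rule: permutes_induct)
  case id
  then show ?case using mod2_perm_one burau_image_one by blast
next
  case (swap a b p)
  obtain A where A: "A \<in> burau_image n" "mod2_perm n p A" using swap by blast
  have "\<exists>S\<in>burau_image n. mod2_perm n (Transposition.transpose a b) S"
    using burau_image_realizes_transpose[of a b n] burau_image_realizes_transpose[of b a n] swap
    by (cases "a < b") (auto simp: transpose_commute)
  then obtain S where S: "S \<in> burau_image n" "mod2_perm n (Transposition.transpose a b) S" by blast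
  have "p \<in> {1..n} \<rightarrow> {1..n}" using permutes_in_image[OF \<open>p permutes {1..n}\<close>] by auto
  then have "mod2_perm n (Transposition.transpose a b \<circ> p) (S * A)"
    using A S Gamma_mat burau_image_Gamma by (intro mod2_perm_mult) blast+
  then show ?case using burau_image_mult[OF S(1) A(1)] by blast
qed

lemma permutes_Pi: "\<pi> permutes S \<Longrightarrow> \<pi> \<in> S \<rightarrow> S"
  by (auto simp: permutes_in_image)

text \<open>The witness for the inclusion of S_n into the quotient. A description by parities avoids
  choosing a lift of each permutation; that it is a coset follows from the lifts found in the Burau
  image.\<close>

definition perm_coset :: "nat \<Rightarrow> (nat \<Rightarrow> nat) \<Rightarrow> int mat set" where
  "perm_coset n \<pi> = {A \<in> carrier (Gamma n). mod2_perm n \<pi> A}"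

lemma Gamma_cong_2: "Gamma_cong n 2 = perm_coset n id"
proof -
  have "[a = of_bool P] (mod int 2) \<longleftrightarrow> (odd a \<longleftrightarrow> P)" for a P
    by (cases P) (auto simp: cong_def odd_iff_mod_2_eq_one)
  moreover have "1\<^sub>m n $$ (i, j) = (of_bool (i = j) :: int)" if "i < n" "j < n" for i j
    using that by simp
  ultimately show ?thesis by (auto simp: Gamma_cong_def perm_coset_def mod2_perm_def)
qed

lemma Gamma_quot_eq_perm_coset:
  assumes A: "A \<in> carrier (Gamma n)" "mod2_perm n \<pi> A" and \<pi>: "\<pi> permutes {1..n}"
  shows "Gamma_quot n 2 A = perm_coset n \<pi>"
proof
  show "Gamma_quot n 2 A \<subseteq> perm_coset n \<pi>"
  proof
    fix B assume "B \<in> Gamma_quot n 2 A"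
    then obtain h where h: "h \<in> perm_coset n id" "B = h * A"
      by (auto simp: Gamma_quot_def r_coset_def Gamma_cong_2)
    then show "B \<in> perm_coset n \<pi>"
      using mod2_perm_mult[OF _ _ Gamma_mat[OF A(1)] A(2) permutes_Pi[OF \<pi>], of h id] A(1) Gamma_mat Gamma_mult
      by (auto simp: perm_coset_def)
  qed
  show "perm_coset n \<pi> \<subseteq> Gamma_quot n 2 A"
  proof
    fix B assume B: "B \<in> perm_coset n \<pi>"
    obtain C where C: "C \<in> carrier (Gamma n)" "A * C = 1\<^sub>m n" "C * A = 1\<^sub>m n"
      using Gamma_inverse[OF A(1)] by blast
    have BG: "B \<in> carrier (Gamma n)" "mod2_perm n \<pi> B" using B by (auto simp: perm_coset_def)
    have "mod2_perm n (inv_into UNIV \<pi>) C"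
      using mod2_perm_inverse[OF Gamma_mat[OF A(1)] A(2) \<pi> Gamma_mat[OF C(1)] C(2)] .
    \<comment> \<open>Two matrices with the same pattern differ by a factor with trivial pattern,
      that is, by an element of the congruence subgroup.\<close>
    then have "mod2_perm n (\<pi> \<circ> inv_into UNIV \<pi>) (B * C)"
      using BG C(1) Gamma_mat permutes_Pi[OF permutes_inv[OF \<pi>]] by (intro mod2_perm_mult) auto
    then have "B * C \<in> Gamma_cong n 2"
      using Gamma_mult[OF BG(1) C(1)] permutes_inv_o(1)[OF \<pi>] by (simp add: Gamma_cong_2 perm_coset_def)
    moreover have "B = B * C * A"
      using assoc_mult_mat[OF Gamma_mat[OF BG(1)] Gamma_mat[OF C(1)] Gamma_mat[OF A(1)]] C(3) Gamma_mat[OF BG(1)]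
      by simp
    ultimately show "B \<in> Gamma_quot n 2 A" by (auto simp: Gamma_quot_def r_coset_def)
  qed
qed

text \<open>Every permutation has a lift among the Burau matrices. Multiplicativity is checked on
  lifts, and injectivity holds because one matrix has only one parity pattern.\<close>

lemma perm_coset_mon: "perm_coset n \<in> mon (sym_group n) (Gamma n Mod Gamma_cong n 2)"
proof -
  interpret N: normal "Gamma_cong n 2" "Gamma n" by (rule normal_Gamma_cong)
  have quot: "Gamma_quot n 2 \<in> hom (Gamma n) (Gamma n Mod Gamma_cong n 2)"
    using N.r_coset_hom_Mod unfolding Gamma_quot_def .
  have ex: "\<exists>A\<in>carrier (Gamma n). mod2_perm n \<pi> A \<and> perm_coset n \<pi> = Gamma_quot n 2 A"
    if "\<pi> permutes {1..n}" for \<pi>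
    using burau_image_realizes_perm[OF that] burau_image_Gamma Gamma_quot_eq_perm_coset that by metis
  have "perm_coset n \<in> hom (sym_group n) (Gamma n Mod Gamma_cong n 2)"
  proof (rule homI)
    fix \<pi> assume "\<pi> \<in> carrier (sym_group n)"
    then show "perm_coset n \<pi> \<in> carrier (Gamma n Mod Gamma_cong n 2)"
      using ex[of \<pi>] quot by (auto simp: sym_group_carrier hom_def)
  next
    fix \<pi> \<tau> assume "\<pi> \<in> carrier (sym_group n)" "\<tau> \<in> carrier (sym_group n)"
    then have \<pi>: "\<pi> permutes {1..n}" and \<tau>: "\<tau> permutes {1..n}" by (simp_all add: sym_group_carrier)
    obtain A where A: "A \<in> carrier (Gamma n)" "mod2_perm n \<pi> A" "perm_coset n \<pi> = Gamma_quot n 2 A"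
      using ex[OF \<pi>] by blast
    obtain B where B: "B \<in> carrier (Gamma n)" "mod2_perm n \<tau> B" "perm_coset n \<tau> = Gamma_quot n 2 B"
      using ex[OF \<tau>] by blast
    have "mod2_perm n (\<pi> \<circ> \<tau>) (A * B)"
      using A B Gamma_mat permutes_Pi[OF \<tau>] by (intro mod2_perm_mult) auto
    then have "perm_coset n (\<pi> \<circ> \<tau>) = Gamma_quot n 2 (A * B)"
      using Gamma_quot_eq_perm_coset Gamma_mult[OF A(1) B(1)] permutes_compose[OF \<tau> \<pi>] by metis
    also have "\<dots> = perm_coset n \<pi> \<otimes>\<^bsub>Gamma n Mod Gamma_cong n 2\<^esub> perm_coset n \<tau>"
      using hom_mult[OF quot A(1) B(1)] A(3) B(3) by simp
    finally show "perm_coset n (\<pi> \<otimes>\<^bsub>sym_group n\<^esub> \<tau>)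
        = perm_coset n \<pi> \<otimes>\<^bsub>Gamma n Mod Gamma_cong n 2\<^esub> perm_coset n \<tau>"
      by (simp add: sym_group_mult)
  qed
  moreover have "inj_on (perm_coset n) (carrier (sym_group n))"
  proof (rule inj_onI)
    fix \<pi> \<tau> assume "\<pi> \<in> carrier (sym_group n)" "\<tau> \<in> carrier (sym_group n)"
      and eq: "perm_coset n \<pi> = perm_coset n \<tau>"
    then have \<pi>: "\<pi> permutes {1..n}" and \<tau>: "\<tau> permutes {1..n}" by (simp_all add: sym_group_carrier)
    obtain A where A: "A \<in> carrier (Gamma n)" "mod2_perm n \<pi> A" using ex[OF \<pi>] by blast
    then have "A \<in> perm_coset n \<tau>" using eq by (auto simp: perm_coset_def)
    then have A': "mod2_perm n \<tau> A" by (simp add: perm_coset_def)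
    show "\<pi> = \<tau>"
    proof
      fix x
      show "\<pi> x = \<tau> x"
      proof (cases "x \<in> {1..n}")
        case True
        then have "\<pi> x \<in> {1..n}" using permutes_in_image[OF \<pi>] by blast
        then obtain i j where "x = Suc j" "j < n" "\<pi> x = Suc i" "i < n"
          using True by (cases x; cases "\<pi> x") auto
        then show ?thesis using A(2) A' by (metis mod2_perm_def)
      next
        case False
        then show ?thesis using permutes_not_in[OF \<pi>] permutes_not_in[OF \<tau>] by simp
      qed
    qed
  qed
  ultimately show ?thesis by (simp add: mon_def)
qed

lemma burau_image_as_preimage:
  shows "\<forall>i < n - 1. perm_coset n (Transposition.transpose (i + 1) (i + 2)) = Gamma_quot n 2 (burau n (artin_gen n i))"
    and "perm_coset n ` carrier (sym_group n) = Gamma_quot n 2 ` burau_image n"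
    and "burau_image n = {A \<in> carrier (Gamma n). Gamma_quot n 2 A \<in> perm_coset n ` carrier (sym_group n)}"
proof -
  show "\<forall>i < n - 1. perm_coset n (Transposition.transpose (i + 1) (i + 2)) = Gamma_quot n 2 (burau n (artin_gen n i))"
  proof (intro allI impI)
    fix i assume i: "i < n - 1"
    have "Transposition.transpose (i + 1) (i + 2) permutes {1..n}"
      using i by (intro permutes_swap_id) auto
    then show "perm_coset n (Transposition.transpose (i + 1) (i + 2)) = Gamma_quot n 2 (burau n (artin_gen n i))"
      using i Gamma_quot_eq_perm_coset[OF burau_gen_Gamma mod2_perm_burau_gen, of i n]
      by (simp add: burau_artin_gen)
  qed
  have sub: "Gamma_quot n 2 A \<in> perm_coset n ` carrier (sym_group n)" if A: "A \<in> burau_image n" for A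
  proof -
    obtain \<sigma> where \<sigma>: "\<sigma> permutes {1..n}" "mod2_perm n \<sigma> A" using burau_image_mod2_perm[OF A] by blast
    then have "Gamma_quot n 2 A = perm_coset n \<sigma>"
      using Gamma_quot_eq_perm_coset[OF burau_image_Gamma[OF A]] by simp
    then show ?thesis using \<sigma>(1) by (simp add: sym_group_carrier)
  qed
  show "perm_coset n ` carrier (sym_group n) = Gamma_quot n 2 ` burau_image n"
  proof (intro equalityI image_subsetI sub)
    fix \<pi> assume "\<pi> \<in> carrier (sym_group n)"
    then have \<pi>: "\<pi> permutes {1..n}" by (simp add: sym_group_carrier)
    obtain A where A: "A \<in> burau_image n" "mod2_perm n \<pi> A" using burau_image_realizes_perm[OF \<pi>] by blast
    have "perm_coset n \<pi> = Gamma_quot n 2 A"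
      using Gamma_quot_eq_perm_coset[OF burau_image_Gamma[OF A(1)] A(2) \<pi>] by simp
    then show "perm_coset n \<pi> \<in> Gamma_quot n 2 ` burau_image n" using A(1) by (rule image_eqI)
  qed
  show "burau_image n = {A \<in> carrier (Gamma n). Gamma_quot n 2 A \<in> perm_coset n ` carrier (sym_group n)}"
  proof (intro equalityI subsetI)
    fix A assume "A \<in> {A \<in> carrier (Gamma n). Gamma_quot n 2 A \<in> perm_coset n ` carrier (sym_group n)}"
    then obtain \<pi> where A: "A \<in> carrier (Gamma n)" and \<pi>: "\<pi> permutes {1..n}" and eq: "Gamma_quot n 2 A = perm_coset n \<pi>"
      by (auto simp: sym_group_carrier)
    \<comment> \<open>Membership of \<open>A\<close> in its own coset turns the equality of cosets
      into a parity pattern for \<open>A\<close>.\<close>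
    have "A \<in> Gamma_quot n 2 A"
      using group.rcos_self[OF group_Gamma A normal_imp_subgroup[OF normal_Gamma_cong]]
      by (simp add: Gamma_quot_def)
    then have "mod2_perm n \<pi> A" unfolding eq by (simp add: perm_coset_def)
    then show "A \<in> burau_image n" using Gamma_mod2_perm_image[OF A _ permutes_Pi[OF \<pi>]] by blast
  next
    fix A assume "A \<in> burau_image n"
    then show "A \<in> {A \<in> carrier (Gamma n). Gamma_quot n 2 A \<in> perm_coset n ` carrier (sym_group n)}"
      using sub[of A] burau_image_Gamma[of A n] by simp
  qed
qed


section \<open>Two and three strands\<close>

lemma det_two:
  assumes "A \<in> carrier_mat 2 2"
  shows "det A = A $$ (0, 0) * A $$ (1, 1) - A $$ (0, 1) * A $$ (1, 0)"
proof -
  have "{0..<2::nat} = {0, 1}" by auto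
  then have perms: "{p. p permutes {0..<2::nat}} = {id, Transposition.transpose 0 1}"
    using permutes_doubleton_iff[of _ 0 "1::nat"] by auto
  have "id \<noteq> Transposition.transpose 0 (1::nat)" by (metis id_apply transpose_apply_first zero_neq_one)
  then show ?thesis
    unfolding det_def'[OF assms] perms by (simp add: numeral_2_eq_2 sign_swap_id sign_id)
qed

lemma sum_lessThan_2: "(\<Sum>i<2. f i) = f 0 + f (1::nat)" for f :: "nat \<Rightarrow> int"
  by (simp add: numeral_2_eq_2)

lemma sum_lessThan_3: "(\<Sum>i<3. f i) = f 0 + f 1 + f (2::nat)" for f :: "nat \<Rightarrow> int"
  by (simp add: numeral_3_eq_3 numeral_2_eq_2)

lemma mat2_mult_vec:
  fixes A :: "int mat"
  assumes "A \<in> carrier_mat 2 2" "v \<in> carrier_vec 2"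
  shows "(A *\<^sub>v v) $ 0 = A $$ (0, 0) * v $ 0 + A $$ (0, Suc 0) * v $ Suc 0"
    and "(A *\<^sub>v v) $ Suc 0 = A $$ (Suc 0, 0) * v $ 0 + A $$ (Suc 0, Suc 0) * v $ Suc 0"
  by (simp_all add: mult_mat_vec_index[OF assms] sum_lessThan_2 del: index_mult_mat_vec)

lemma symp2_mult_mat_vec:
  assumes "A \<in> carrier_mat 2 2" "v \<in> carrier_vec 2" "w \<in> carrier_vec 2"
  shows "symp2 (A *\<^sub>v v) (A *\<^sub>v w) = det A * symp2 v w"
  unfolding symp2_def One_nat_def mat2_mult_vec[OF assms(1,2)] mat2_mult_vec[OF assms(1,3)] det_two[OF assms(1)]
  by (simp add: algebra_simps)

text \<open>A matrix scales \<open>symp2\<close> by its determinant, and the standard basis is a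
  pair on which \<open>symp2\<close> equals 1.\<close>

lemma SL2_eq_Sp2: "SL2 = Sp2"
proof -
  have "det A = 1 \<longleftrightarrow> (\<forall>v\<in>carrier_vec 2. \<forall>w\<in>carrier_vec 2. symp2 (A *\<^sub>v v) (A *\<^sub>v w) = symp2 v w)"
    if "A \<in> carrier (GL_int 2)" for A
  proof -
    note symp2 = symp2_mult_mat_vec[OF GL_int_mat[OF that]]
    have "symp2 (unit_vec 2 0) (unit_vec 2 1) = 1" by (simp add: symp2_def)
    then have "det A = symp2 (A *\<^sub>v unit_vec 2 0) (A *\<^sub>v unit_vec 2 1)" by (simp add: symp2)
    then show ?thesis using symp2 \<open>symp2 (unit_vec 2 0) (unit_vec 2 1) = 1\<close> by auto
  qed
  then have "{A \<in> carrier (GL_int 2). det A = 1} = {A \<in> carrier (GL_int 2).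
     \<forall>v \<in> carrier_vec 2. \<forall>w \<in> carrier_vec 2. symp2 (A *\<^sub>v v) (A *\<^sub>v w) = symp2 v w}" by blast
  then show ?thesis by (simp add: SL2_def Sp2_def)
qed

lemma Sp2_simps [simp]: "A \<otimes>\<^bsub>Sp2\<^esub> B = A * B" "\<one>\<^bsub>Sp2\<^esub> = 1\<^sub>m 2"
  by (simp_all add: Sp2_def)

lemma Sp2_iff: "A \<in> carrier Sp2 \<longleftrightarrow> A \<in> carrier (GL_int 2) \<and> det A = 1"
  unfolding SL2_eq_Sp2[symmetric] by (simp add: SL2_def)

section \<open>Restriction to symplectic planes\<close>

lemma restr_matrix_eqI:
  assumes U: "U \<in> carrier_mat n m" and L: "L \<in> carrier_mat m n" and LU: "L * U = 1\<^sub>m m"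
    and A: "A \<in> carrier_mat n n" and M: "M \<in> carrier_mat m m" and AU: "A * U = U * M"
  shows "restr_matrix U A = M"
  unfolding restr_matrix_def
proof (rule the_equality)
  show "M \<in> carrier_mat (dim_col U) (dim_col U) \<and> A * U = U * M" using assms by auto
  fix N assume "N \<in> carrier_mat (dim_col U) (dim_col U) \<and> A * U = U * N"
  then have N: "N \<in> carrier_mat m m" "U * M = U * N" using U AU by auto
  \<comment> \<open>The left inverse \<open>L\<close> cancels \<open>U\<close>, which gives the
    uniqueness required by the definite description.\<close>
  have "L * U * M = L * U * N" using N U L M by (simp add: assoc_mult_mat[of _ m n _ m _ m])
  then show "N = M" using LU M N by simp
qed

text \<open>Common setting for both low-dimensional identifications. \<open>L\<close> reads off
  coordinates in the basis \<open>U\<close>, so the restriction of \<open>A\<close> must have the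
  matrix \<open>L * A * U\<close>; the last assumption expresses invariance of the
  sublattice.\<close>

locale symplectic_sublattice =
  fixes n :: nat and U L :: "int mat"
  assumes U: "U \<in> carrier_mat n 2" and L: "L \<in> carrier_mat 2 n" and LU: "L * U = 1\<^sub>m 2"
    and form_U: "\<And>v w. v \<in> carrier_vec 2 \<Longrightarrow> w \<in> carrier_vec 2 \<Longrightarrow> form n (U *\<^sub>v v) (U *\<^sub>v w) = symp2 v w"
    and invariant: "\<And>A. A \<in> carrier (Gamma n) \<Longrightarrow> A * U = U * (L * A * U)"
begin

lemma restr_mat: "A \<in> carrier (Gamma n) \<Longrightarrow> L * A * U \<in> carrier_mat 2 2"
  using mult_carrier_mat[OF mult_carrier_mat[OF L Gamma_mat] U] .

lemma restr_eq: "A \<in> carrier (Gamma n) \<Longrightarrow> restr_matrix U A = L * A * U"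
  using restr_matrix_eqI[OF U L LU Gamma_mat restr_mat invariant] .

lemma restr_mult:
  assumes "A \<in> carrier (Gamma n)" "B \<in> carrier (Gamma n)"
  shows "restr_matrix U (A * B) = restr_matrix U A * restr_matrix U B"
proof -
  let ?M = "L * A * U" and ?N = "L * B * U"
  note m = Gamma_mat[OF assms(1)] Gamma_mat[OF assms(2)] restr_mat[OF assms(1)] restr_mat[OF assms(2)] U L
  have "A * B * U = A * (B * U)" using m by (intro assoc_mult_mat) auto
  also have "\<dots> = A * (U * ?N)" using invariant[OF assms(2)] by simp
  also have "\<dots> = A * U * ?N" using m by (intro assoc_mult_mat[symmetric]) auto
  also have "\<dots> = U * ?M * ?N" using invariant[OF assms(1)] by simp
  also have "\<dots> = U * (?M * ?N)" using m by (intro assoc_mult_mat) auto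
  finally have "restr_matrix U (A * B) = ?M * ?N"
    using mult_carrier_mat[OF m(1,2)] mult_carrier_mat[OF m(3,4)] by (intro restr_matrix_eqI[OF U L LU])
  then show ?thesis using restr_eq assms by simp
qed

lemma U_restr_mult_vec:
  assumes "A \<in> carrier (Gamma n)" "v \<in> carrier_vec 2"
  shows "U *\<^sub>v (restr_matrix U A *\<^sub>v v) = A *\<^sub>v (U *\<^sub>v v)"
proof -
  have "U *\<^sub>v (restr_matrix U A *\<^sub>v v) = U * restr_matrix U A *\<^sub>v v"
    using U restr_mat assms restr_eq by (intro assoc_mult_mat_vec[symmetric, of _ n 2 _ 2]) auto
  also have "\<dots> = A * U *\<^sub>v v" using invariant assms restr_eq by simp
  also have "\<dots> = A *\<^sub>v (U *\<^sub>v v)"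
    using U Gamma_mat assms by (intro assoc_mult_mat_vec[of _ n n _ 2]) auto
  finally show ?thesis .
qed

lemma restr_hom: "restr_matrix U \<in> hom (Gamma n) Sp2"
proof (rule homI)
  fix A assume A: "A \<in> carrier (Gamma n)"
  obtain B where B: "B \<in> carrier (Gamma n)" "A * B = 1\<^sub>m n" "B * A = 1\<^sub>m n"
    using Gamma_inverse[OF A] by blast
  have "restr_matrix U (1\<^sub>m n) = 1\<^sub>m 2"
    using restr_matrix_eqI[OF U L LU _ one_carrier_mat] U by simp
  then have "restr_matrix U A * restr_matrix U B = 1\<^sub>m 2" "restr_matrix U B * restr_matrix U A = 1\<^sub>m 2"
    using restr_mult A B by metis+
  then have GL: "restr_matrix U A \<in> carrier (GL_int 2)"
    using restr_mat restr_eq A B(1) by (auto simp: GL_int_iff)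
  have "symp2 (restr_matrix U A *\<^sub>v v) (restr_matrix U A *\<^sub>v w) = symp2 v w"
    if vw: "v \<in> carrier_vec 2" "w \<in> carrier_vec 2" for v w
  proof -
    have "restr_matrix U A *\<^sub>v v \<in> carrier_vec 2" "restr_matrix U A *\<^sub>v w \<in> carrier_vec 2"
      using GL_int_mat[OF GL] vw by auto
    then have "symp2 (restr_matrix U A *\<^sub>v v) (restr_matrix U A *\<^sub>v w)
        = form n (A *\<^sub>v (U *\<^sub>v v)) (A *\<^sub>v (U *\<^sub>v w))"
      using form_U U_restr_mult_vec[OF A] vw by metis
    also have "\<dots> = form n (U *\<^sub>v v) (U *\<^sub>v w)" using U vw by (intro Gamma_preserves(1)[OF A]) auto
    finally show ?thesis using form_U vw by simp
  qed
  then show "restr_matrix U A \<in> carrier Sp2" using GL by (simp add: Sp2_def)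
qed (simp add: restr_mult)

end

lemma eq_vec2I:
  "v \<in> carrier_vec 2 \<Longrightarrow> w \<in> carrier_vec 2 \<Longrightarrow> v $ 0 = w $ 0 \<Longrightarrow> v $ 1 = w $ 1 \<Longrightarrow> v = w"
  by (intro eq_vecI) (auto simp: less_2_cases_iff)

lemma eq_mat2I:
  assumes "A \<in> carrier_mat 2 2" "B \<in> carrier_mat 2 2"
    and "A $$ (0, 0) = B $$ (0, 0)" "A $$ (0, 1) = B $$ (0, 1)"
      "A $$ (1, 0) = B $$ (1, 0)" "A $$ (1, 1) = B $$ (1, 1)"
  shows "A = B"
  using assms by (intro eq_matI) (auto simp: less_2_cases_iff)

lemma less_3_cases_iff: "i < 3 \<longleftrightarrow> i = 0 \<or> i = 1 \<or> i = (2::nat)"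
  by auto

lemma mult_mat_index:
  fixes A :: "int mat"
  assumes "A \<in> carrier_mat a b" "B \<in> carrier_mat b c" "i < a" "j < c"
  shows "(A * B) $$ (i, j) = (\<Sum>k<b. A $$ (i, k) * B $$ (k, j))"
  using assms by (simp add: scalar_prod_def lessThan_atLeast0)

section \<open>Parity of columns on two and three strands\<close>

lemma Gamma_row_sum:
  assumes "A \<in> carrier (Gamma n)" "i < n"
  shows "(\<Sum>j<n. A $$ (i, j)) = 1"
proof -
  have "(A *\<^sub>v v_vec n) $ i = (\<Sum>j<n. A $$ (i, j))"
    unfolding mult_mat_vec_index[OF Gamma_mat[OF assms(1)] v_vec_carrier assms(2)]
    by (intro sum.cong) (auto simp: v_vec_def)
  then show ?thesis using Gamma_preserves(2)[OF assms(1)] assms(2) by (simp add: v_vec_def)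
qed

lemma Gamma_column_alt_sum:
  assumes "A \<in> carrier (Gamma n)" "j < n"
  shows "(\<Sum>i<n. (-1) ^ i * A $$ (i, j)) = (-1) ^ j"
proof -
  have "w_vec n \<bullet> (A *\<^sub>v unit_vec n j) = (\<Sum>i<n. (-1) ^ i * A $$ (i, j))"
    using Gamma_mat[OF assms(1)] assms(2) by (subst w_vec_scalar_prod) (auto intro!: sum.cong)
  moreover have "w_vec n \<bullet> unit_vec n j = (-1) ^ j" using assms(2) by (simp add: w_vec_def)
  ultimately show ?thesis using Gamma_w_vec[OF assms(1), of "unit_vec n j"] by simp
qed

lemma burau_image_eq_Gamma:
  assumes odd: "\<And>A j. A \<in> carrier (Gamma n) \<Longrightarrow> j < n \<Longrightarrow> \<exists>m<n. \<forall>i<n. odd (A $$ (i, j)) \<longleftrightarrow> i = m"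
  shows "burau_image n = carrier (Gamma n)"
proof
  show "carrier (Gamma n) \<subseteq> burau_image n"
  proof
    fix A assume A: "A \<in> carrier (Gamma n)"
    obtain f where f: "\<And>j. j < n \<Longrightarrow> f j < n \<and> (\<forall>i<n. odd (A $$ (i, j)) \<longleftrightarrow> i = f j)"
      using odd[OF A] by metis
    \<comment> \<open>The shifts translate the 0-based \<open>f\<close> to the set {1..n}. At this
      point \<open>f\<close> is only a self-map.\<close>
    have "mod2_perm n (\<lambda>j. Suc (f (j - 1))) A" using f by (auto simp: mod2_perm_def)
    moreover have "(\<lambda>j. Suc (f (j - 1))) \<in> {1..n} \<rightarrow> {1..n}" using f by (auto simp: Suc_le_eq)
    ultimately show "A \<in> burau_image n" using Gamma_mod2_perm_image[OF A] by blast
  qed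
qed (use burau_image_Gamma in blast)

text \<open>The alternating sum of a column is odd, so exactly one of its two entries is
  odd.\<close>

lemma burau_image_2: "burau_image 2 = carrier (Gamma 2)"
proof (rule burau_image_eq_Gamma)
  fix A :: "int mat" and j :: nat assume A: "A \<in> carrier (Gamma 2)" "j < 2"
  have "A $$ (0, j) - A $$ (1, j) = (-1) ^ j"
    using Gamma_column_alt_sum[OF A] by (simp add: sum_lessThan_2)
  then have "odd (A $$ (0, j) - A $$ (1, j))" by simp
  then have "odd (A $$ (0, j)) \<longleftrightarrow> even (A $$ (1, j))" by simp
  then show "\<exists>m<2. \<forall>i<2. odd (A $$ (i, j)) \<longleftrightarrow> i = m"
    by (intro exI[of _ "if odd (A $$ (0, j)) then 0 else 1"]) (auto simp: less_2_cases_iff)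
qed

text \<open>The odd alternating sum leaves one or three odd entries in a column. Three are
  impossible: then 2 would divide all entries minus 1, against
  \<open>Gamma_column_differences\<close>.\<close>

lemma burau_image_3: "burau_image 3 = carrier (Gamma 3)"
proof (rule burau_image_eq_Gamma)
  fix A :: "int mat" and j :: nat assume A: "A \<in> carrier (Gamma 3)" and j: "j < 3"
  have "A $$ (0, j) - A $$ (1, j) + A $$ (2, j) = (-1) ^ j"
    using Gamma_column_alt_sum[OF A j] by (simp add: sum_lessThan_3)
  then have "odd (A $$ (0, j) - A $$ (1, j) + A $$ (2, j))" by simp
  then have par: "odd (A $$ (0, j)) \<longleftrightarrow> (odd (A $$ (1, j)) \<longleftrightarrow> odd (A $$ (2, j)))" by auto
  have "\<exists>i<3. even (A $$ (i, j))"
  proof (rule ccontr)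
    assume "\<not> ?thesis"
    then have "2 dvd A $$ (i, j) - 1" if "i < 3" for i using that by simp
    then have "2 dvd (1::int)"
      using j by (intro Gamma_column_differences[OF A, of 0 j "if j = 0 then 1 else 0"]) auto
    then show False by simp
  qed
  then show "\<exists>m<3. \<forall>i<3. odd (A $$ (i, j)) \<longleftrightarrow> i = m"
    using par by (intro exI[of _ "if odd (A $$ (0, j)) then 0 else if odd (A $$ (1, j)) then 1 else 2"])
      (auto simp: less_3_cases_iff)
qed

section \<open>Explicit coordinates on the two planes\<close>

lemma stabilizer_simps [simp]:
  "A \<otimes>\<^bsub>stabilizer G x\<^esub> B = A \<otimes>\<^bsub>G\<^esub> B"
  "carrier (stabilizer G x) = {A \<in> carrier G. A *\<^sub>v x = x}"
  by (simp_all add: stabilizer_def)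

lemma basis2_entries:
  "basis2 \<in> carrier_mat 2 2"
  "basis2 $$ (0, 0) = 1" "basis2 $$ (0, Suc 0) = 0" "basis2 $$ (Suc 0, 0) = 1" "basis2 $$ (Suc 0, Suc 0) = 1"
  by (rule carrier_matI) (simp_all add: basis2_def v_vec_def mat_of_cols_index)

lemma basis3_entries:
  "basis3 \<in> carrier_mat 3 2"
  "basis3 $$ (0, 0) = 1" "basis3 $$ (0, Suc 0) = 0" "basis3 $$ (Suc 0, 0) = 1"
  "basis3 $$ (Suc 0, Suc 0) = 1" "basis3 $$ (2, 0) = 0" "basis3 $$ (2, Suc 0) = 1"
  by (rule carrier_matI) (simp_all add: basis3_def mat_of_cols_index)

lemma form_2: "form 2 x y = symp2 x y"
  by (simp add: form_def sum_lessThan_2 form_coeff_def symp2_def)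

text \<open>The differences x_2 - x_3 and x_2 - x_1 (numbered from 1) are the coordinates of x in
  \<open>basis3\<close> modulo v_3, so this is the standard symplectic form pulled back along the
  projection that kills v_3.\<close>

lemma form_3:
  "form 3 x y = (x $ 1 - x $ 2) * (y $ 1 - y $ 0) - (x $ 1 - x $ 0) * (y $ 1 - y $ 2)"
  by (simp add: form_def sum_lessThan_3 form_coeff_def algebra_simps)

text \<open>Here \<open>?L\<close> is the two-sided inverse of \<open>basis2\<close>, so invariance
  is automatic.\<close>

lemma symplectic_sublattice_basis2:
  "symplectic_sublattice 2 basis2 (mat 2 2 (\<lambda>(i, j). if i = j then 1 else if j = 0 then -1 else 0))"
    (is "symplectic_sublattice 2 basis2 ?L")
proof
  show "basis2 \<in> carrier_mat 2 2" "?L \<in> carrier_mat 2 2" by (simp_all add: basis2_entries)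
  note dims = this
  show "?L * basis2 = 1\<^sub>m 2"
    using dims by (intro eq_mat2I)
      (auto simp: mult_mat_index[OF dims(2,1)] sum_lessThan_2 basis2_entries intro: mult_carrier_mat[of _ 2 2 _ 2] simp del: index_mult_mat(1) index_mult_mat_vec)
  have UL: "basis2 * ?L = 1\<^sub>m 2"
    using dims by (intro eq_mat2I)
      (auto simp: mult_mat_index[OF dims] sum_lessThan_2 basis2_entries intro: mult_carrier_mat[of _ 2 2 _ 2] simp del: index_mult_mat(1) index_mult_mat_vec)
  show "A * basis2 = basis2 * (?L * A * basis2)" if "A \<in> carrier (Gamma 2)" for A
  proof -
    note Am = Gamma_mat[OF that]
    note AU = mult_carrier_mat[OF Am dims(1)]
    have "basis2 * (?L * A * basis2) = basis2 * ?L * (A * basis2)"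
      unfolding assoc_mult_mat[OF dims(2) Am dims(1)] by (rule assoc_mult_mat[OF dims AU, symmetric])
    then show ?thesis unfolding UL using left_mult_one_mat[OF AU] by simp
  qed
  show "form 2 (basis2 *\<^sub>v v) (basis2 *\<^sub>v w) = symp2 v w" if "v \<in> carrier_vec 2" "w \<in> carrier_vec 2" for v w
    using symp2_mult_mat_vec[OF dims(1) that] by (simp add: form_2 det_two[OF dims(1)] basis2_entries)
qed

text \<open>Here \<open>?L\<close> picks the outer two coordinates. On the kernel of w_3 the middle
  coordinate is their sum, so nothing is lost.\<close>

lemma symplectic_sublattice_basis3:
  "symplectic_sublattice 3 basis3 (mat 2 3 (\<lambda>(i, j). if j = 2 * i then 1 else 0))"
    (is "symplectic_sublattice 3 basis3 ?L")
proof
  show "basis3 \<in> carrier_mat 3 2" "?L \<in> carrier_mat 2 3" by (simp_all add: basis3_entries)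
  note dims = this
  show "?L * basis3 = 1\<^sub>m 2"
    using dims by (intro eq_mat2I)
      (auto simp: mult_mat_index[OF dims(2,1)] sum_lessThan_3 basis3_entries intro: mult_carrier_mat[of _ 2 3 _ 2] simp del: index_mult_mat(1) index_mult_mat_vec)
  show "A * basis3 = basis3 * (?L * A * basis3)" if A: "A \<in> carrier (Gamma 3)" for A
  proof (rule eq_matI)
    note Am = Gamma_mat[OF A]
    have AU: "A * basis3 \<in> carrier_mat 3 2" and LAU: "?L * (A * basis3) \<in> carrier_mat 2 2"
      using mult_carrier_mat[OF Am dims(1)] mult_carrier_mat[OF dims(2) mult_carrier_mat[OF Am dims(1)]] .
    have assoc: "?L * A * basis3 = ?L * (A * basis3)" using dims Am by (intro assoc_mult_mat)
    fix i j assume "i < dim_row (basis3 * (?L * A * basis3))" "j < dim_col (basis3 * (?L * A * basis3))"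
    then have i: "i < 3" and j: "j < 2" using dims by simp_all
    \<comment> \<open>Adjacent columns of \<open>A\<close> have opposite alternating sums, so the
      columns of \<open>A * basis3\<close> lie in the kernel of w_3.\<close>
    have alt: "A $$ (0, k) - A $$ (1, k) + A $$ (2, k) = (-1) ^ k" if "k < 3" for k
      using Gamma_column_alt_sum[OF A that] by (simp add: sum_lessThan_3)
    show "(A * basis3) $$ (i, j) = (basis3 * (?L * A * basis3)) $$ (i, j)"
      using i j alt[of 0] alt[of 1] alt[of 2] unfolding assoc
      by (auto simp: mult_mat_index[OF dims(1) LAU] mult_mat_index[OF dims(2) AU] mult_mat_index[OF Am dims(1)]
          sum_lessThan_3 sum_lessThan_2 basis3_entries less_3_cases_iff less_2_cases_iff simp del: index_mult_mat(1) index_mult_mat_vec)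
  qed (use Gamma_mat[OF A] dims in auto)
  show "form 3 (basis3 *\<^sub>v v) (basis3 *\<^sub>v w) = symp2 v w" if v: "v \<in> carrier_vec 2" and w: "w \<in> carrier_vec 2" for v w
  proof -
    have "(basis3 *\<^sub>v x) $ i = basis3 $$ (i, 0) * x $ 0 + basis3 $$ (i, 1) * x $ 1"
      if "x \<in> carrier_vec 2" "i < 3" for x i
      using that dims by (simp add: scalar_prod_def numeral_2_eq_2)
    then show ?thesis using v w by (simp add: form_3 symp2_def basis3_entries algebra_simps)
  qed
qed

interpretation basis2: symplectic_sublattice 2 basis2
  "mat 2 2 (\<lambda>(i, j). if i = j then 1 else if j = 0 then -1 else 0)"
  by (rule symplectic_sublattice_basis2)

interpretation basis3: symplectic_sublattice 3 basis3 "mat 2 3 (\<lambda>(i, j). if j = 2 * i then 1 else 0)"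
  by (rule symplectic_sublattice_basis3)

lemma (in symplectic_sublattice) restr_mult_eq:
  "A \<in> carrier (Gamma n) \<Longrightarrow> A * U = U * restr_matrix U A"
  using invariant restr_eq by simp

lemma inj_on_restr_basis2: "inj_on (restr_matrix basis2) (carrier (Gamma 2))"
proof (rule inj_onI)
  fix A B assume A: "A \<in> carrier (Gamma 2)" and B: "B \<in> carrier (Gamma 2)"
    and eq: "restr_matrix basis2 A = restr_matrix basis2 B"
  note Am = Gamma_mat[OF A] and Bm = Gamma_mat[OF B]
  have "A * basis2 = B * basis2" using eq basis2.restr_mult_eq A B by metis
  then have "(\<Sum>k<2. A $$ (i, k) * basis2 $$ (k, j)) = (\<Sum>k<2. B $$ (i, k) * basis2 $$ (k, j))" if "i < 2" "j < 2" for i j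
    using mult_mat_index[OF Am basis2_entries(1) that] mult_mat_index[OF Bm basis2_entries(1) that] by simp
  from this[of _ 0] this[of _ 1]
  have "A $$ (i, 0) + A $$ (i, 1) = B $$ (i, 0) + B $$ (i, 1)" "A $$ (i, 1) = B $$ (i, 1)" if "i < 2" for i
    using that by (simp_all add: sum_lessThan_2 basis2_entries)
  from this[of 0] this[of 1] show "A = B" using Am Bm by (intro eq_mat2I) auto
qed

text \<open>The columns of \<open>basis3\<close> together with v_3 generate the whole lattice, and
  v_3 is fixed; in coordinates, two adjacent sums and the total determine each row.\<close>

lemma inj_on_restr_basis3: "inj_on (restr_matrix basis3) (carrier (Gamma 3))"
proof (rule inj_onI)
  fix A B assume A: "A \<in> carrier (Gamma 3)" and B: "B \<in> carrier (Gamma 3)"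
    and eq: "restr_matrix basis3 A = restr_matrix basis3 B"
  note Am = Gamma_mat[OF A] and Bm = Gamma_mat[OF B]
  have "A * basis3 = B * basis3" using eq basis3.restr_mult_eq A B by metis
  then have "(\<Sum>k<3. A $$ (i, k) * basis3 $$ (k, j)) = (\<Sum>k<3. B $$ (i, k) * basis3 $$ (k, j))" if "i < 3" "j < 2" for i j
    using mult_mat_index[OF Am basis3_entries(1) that] mult_mat_index[OF Bm basis3_entries(1) that] by simp
  from this[of _ 0] this[of _ 1]
  have "A $$ (i, 0) + A $$ (i, 1) = B $$ (i, 0) + B $$ (i, 1)"
    "A $$ (i, 1) + A $$ (i, 2) = B $$ (i, 1) + B $$ (i, 2)" if "i < 3" for i
    using that by (simp_all add: sum_lessThan_3 basis3_entries)
  moreover have "A $$ (i, 0) + A $$ (i, 1) + A $$ (i, 2) = 1" "B $$ (i, 0) + B $$ (i, 1) + B $$ (i, 2) = 1"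
    if "i < 3" for i
    using Gamma_row_sum[OF A that] Gamma_row_sum[OF B that] by (simp_all add: sum_lessThan_3)
  ultimately have row: "A $$ (i, 0) = B $$ (i, 0)" "A $$ (i, 1) = B $$ (i, 1)" "A $$ (i, 2) = B $$ (i, 2)"
    if "i < 3" for i using that by (smt (verit))+
  show "A = B"
  proof (rule eq_matI)
    fix i j assume "i < dim_row B" "j < dim_col B"
    then have "i < 3" "j = 0 \<or> j = 1 \<or> j = 2" using Bm by (auto simp: less_3_cases_iff)
    then show "A $$ (i, j) = B $$ (i, j)" using row by blast
  qed (use Am Bm in auto)
qed

text \<open>The first vector of \<open>basis2\<close> is v_2, which Gamma fixes.\<close>

lemma restr_basis2_stabilizes:
  assumes A: "A \<in> carrier (Gamma 2)"
  shows "restr_matrix basis2 A *\<^sub>v unit_vec 2 0 = unit_vec 2 0"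
proof -
  let ?M = "restr_matrix basis2 A"
  have M: "?M \<in> carrier_mat 2 2" using basis2.restr_mat basis2.restr_eq A by simp
  have U: "basis2 *\<^sub>v unit_vec 2 0 = v_vec 2"
    using basis2_entries
    by (intro eq_vec2I) (auto simp: mat2_mult_vec[OF basis2_entries(1)] v_vec_def intro!: mult_mat_vec_carrier)
  have "basis2 *\<^sub>v (?M *\<^sub>v unit_vec 2 0) = basis2 *\<^sub>v unit_vec 2 0"
    using basis2.U_restr_mult_vec[OF A, of "unit_vec 2 0"] Gamma_preserves(2)[OF A] U by simp
  moreover have "\<exists>!y. y \<in> carrier_vec 2 \<and> basis2 *\<^sub>v unit_vec 2 0 = basis2 *\<^sub>v y"
    using U by (intro basis2_span) simp
  moreover have "?M *\<^sub>v unit_vec 2 0 \<in> carrier_vec 2" using M by auto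
  ultimately show ?thesis by (metis unit_vec_carrier)
qed

section \<open>The stabilizer as a group of shears\<close>

lemma stabilizer_Sp2_entries:
  assumes "M \<in> carrier (stabilizer Sp2 (unit_vec 2 0))"
  shows "M \<in> carrier_mat 2 2" "M $$ (0, 0) = 1" "M $$ (Suc 0, 0) = 0" "M $$ (Suc 0, Suc 0) = 1"
proof -
  show M: "M \<in> carrier_mat 2 2" using assms GL_int_mat by (auto simp: Sp2_iff)
  have fix0: "M *\<^sub>v unit_vec 2 0 = unit_vec 2 0" using assms by simp
  show 1: "M $$ (0, 0) = 1" "M $$ (Suc 0, 0) = 0"
    using arg_cong[OF fix0, of "\<lambda>v. v $ 0"] arg_cong[OF fix0, of "\<lambda>v. v $ 1"] M by simp_all
  have "det M = 1" using assms by (simp add: Sp2_iff)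
  then show "M $$ (Suc 0, Suc 0) = 1" using 1 det_two[OF M] by simp
qed

lemma GL_int_2I:
  assumes A: "A \<in> carrier_mat 2 2" and det: "det A = 1"
  shows "A \<in> carrier (GL_int 2)"
proof -
  have "1 \<cdot>\<^sub>m 1\<^sub>m 2 = (1\<^sub>m 2 :: int mat)" by (rule eq_matI) auto
  then show ?thesis using adj_mat[OF A] A det by (auto simp: GL_int_iff)
qed

definition shear :: "int \<Rightarrow> int mat" where
  "shear m = mat 2 2 (\<lambda>(i, j). if i = j then 1 else if i = 0 then m else 0)"

lemma shear_mat [simp]: "shear m \<in> carrier_mat 2 2"
  by (simp add: shear_def)

lemma shear_entries:
  "shear m $$ (0, 0) = 1" "shear m $$ (0, Suc 0) = m" "shear m $$ (Suc 0, 0) = 0" "shear m $$ (Suc 0, Suc 0) = 1"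
  by (simp_all add: shear_def)

lemma shear_mult: "shear a * shear b = shear (a + b)"
  by (intro eq_mat2I mult_carrier_mat[of _ 2 2 _ 2])
    (auto simp: mult_mat_index[of _ 2 2 _ 2] sum_lessThan_2 shear_entries simp del: index_mult_mat(1) index_mult_mat_vec)

lemma carrier_stabilizer_Sp2: "carrier (stabilizer Sp2 (unit_vec 2 0)) = range shear"
proof (intro equalityI subsetI)
  fix M assume M: "M \<in> carrier (stabilizer Sp2 (unit_vec 2 0))"
  have "M = shear (M $$ (0, 1))"
    using stabilizer_Sp2_entries[OF M] by (intro eq_mat2I) (auto simp: shear_def)
  then show "M \<in> range shear" by blast
next
  fix M assume "M \<in> range shear"
  then obtain m where M: "M = shear m" by blast
  have "det M = 1" using det_two[of M] M by (simp add: shear_def)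
  moreover have "M *\<^sub>v unit_vec 2 0 = unit_vec 2 0"
    unfolding M using mult_mat_vec_carrier[OF shear_mat unit_vec_carrier]
    by (intro eq_vec2I) (auto simp: mat2_mult_vec[OF shear_mat] shear_entries simp del: index_mult_mat(1) index_mult_mat_vec)
  ultimately show "M \<in> carrier (stabilizer Sp2 (unit_vec 2 0))"
    using M GL_int_2I[of M] by (simp add: Sp2_iff)
qed

lemma inj_shear: "inj shear"
proof (rule injI)
  fix a b assume "shear a = shear b"
  then have "shear a $$ (0, 1) = shear b $$ (0, 1)" by simp
  then show "a = b" by (simp add: shear_def)
qed

lemma stabilizer_Sp2_cong_integer_group: "stabilizer Sp2 (unit_vec 2 0) \<cong> integer_group"
proof -
  have "group (stabilizer Sp2 (unit_vec 2 0))"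
  proof (rule groupI)
    let ?G = "stabilizer Sp2 (unit_vec 2 0)"
    have one: "\<one>\<^bsub>?G\<^esub> = shear 0"
      by (auto simp: stabilizer_def shear_def intro!: eq_mat2I)
    show "\<one>\<^bsub>?G\<^esub> \<in> carrier ?G" unfolding carrier_stabilizer_Sp2 one by simp
    show "\<exists>y\<in>carrier ?G. y \<otimes>\<^bsub>?G\<^esub> x = \<one>\<^bsub>?G\<^esub>" if x: "x \<in> carrier ?G" for x
    proof -
      obtain m where m: "x = shear m" using x unfolding carrier_stabilizer_Sp2 by blast
      then show ?thesis unfolding carrier_stabilizer_Sp2 one
        by (intro bexI[of _ "shear (- m)"]) (auto simp: shear_mult)
    qed
  qed (unfold carrier_stabilizer_Sp2, auto simp: shear_mult add.assoc stabilizer_def left_mult_one_mat[OF shear_mat])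
  moreover have "shear \<in> iso integer_group (stabilizer Sp2 (unit_vec 2 0))"
  proof (rule isoI)
    show "shear \<in> hom integer_group (stabilizer Sp2 (unit_vec 2 0))"
      by (rule homI) (simp_all only: carrier_stabilizer_Sp2, simp_all add: shear_mult)
    show "bij_betw shear (carrier integer_group) (carrier (stabilizer Sp2 (unit_vec 2 0)))"
      unfolding carrier_stabilizer_Sp2 using inj_shear by (simp add: bij_betw_def)
  qed
  then have "integer_group \<cong> stabilizer Sp2 (unit_vec 2 0)" by (auto simp: is_iso_def)
  ultimately show ?thesis using group.iso_sym group_integer_group by blast
qed

lemma shear_lifts:
  "\<exists>A\<in>carrier (Gamma 2). restr_matrix basis2 A = shear m"
proof -
  \<comment> \<open>This is \<open>basis2 * shear m\<close> times the inverse of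
    \<open>basis2\<close>, that is, x -> x + m (x_2 - x_1) v_2; the value m = -1 gives the Burau
    generator.\<close>
  define A :: "int mat" where
    "A = mat 2 2 (\<lambda>(i, j). if i = j then (if i = 0 then 1 - m else 1 + m) else if i = 0 then m else - m)"
  have Am: "A \<in> carrier_mat 2 2" by (simp add: A_def)
  have entries: "A $$ (0, 0) = 1 - m" "A $$ (0, Suc 0) = m" "A $$ (Suc 0, 0) = - m" "A $$ (Suc 0, Suc 0) = 1 + m"
    by (simp_all add: A_def)
  have det: "det A = 1" unfolding det_two[OF Am] by (simp add: entries algebra_simps)
  have "A *\<^sub>v v_vec 2 = v_vec 2"
  proof (rule eq_vec2I)
    show "A *\<^sub>v v_vec 2 \<in> carrier_vec 2" using Am by simp
  qed (simp_all add: mat2_mult_vec[OF Am v_vec_carrier] entries del: index_mult_mat_vec, simp_all add: v_vec_def)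
  moreover have "transpose_mat A *\<^sub>v w_vec 2 = w_vec 2"
  proof (rule eq_vec2I)
    have At: "transpose_mat A \<in> carrier_mat 2 2" using Am by simp
    then show "transpose_mat A *\<^sub>v w_vec 2 \<in> carrier_vec 2" by simp
    show "(transpose_mat A *\<^sub>v w_vec 2) $ 0 = w_vec 2 $ 0" "(transpose_mat A *\<^sub>v w_vec 2) $ 1 = w_vec 2 $ 1"
      using Am by (simp_all add: mat2_mult_vec[OF At w_vec_carrier] entries del: index_mult_mat_vec, simp_all add: w_vec_def)
  qed simp
  ultimately have "A \<in> carrier (Gamma 2)"
    using GL_int_2I[OF Am det] symp2_mult_mat_vec[OF Am] det by (simp add: Gamma_def form_2)
  moreover have "restr_matrix basis2 A = shear m"
    using Am basis2_entries
    by (intro restr_matrix_eqI[OF basis2.U basis2.L basis2.LU] eq_mat2I)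
      (auto simp: mult_mat_index[of _ 2 2 _ 2] sum_lessThan_2 entries shear_entries basis2_entries intro!: mult_carrier_mat[of _ 2 2 _ 2] simp del: index_mult_mat(1) index_mult_mat_vec)
  ultimately show ?thesis by blast
qed

lemma restr_basis2_iso: "restr_matrix basis2 \<in> iso (Gamma 2) (stabilizer Sp2 (unit_vec 2 0))"
proof (rule isoI)
  show hom: "restr_matrix basis2 \<in> hom (Gamma 2) (stabilizer Sp2 (unit_vec 2 0))"
    using basis2.restr_hom restr_basis2_stabilizes by (auto simp: hom_def)
  have "carrier (stabilizer Sp2 (unit_vec 2 0)) \<subseteq> restr_matrix basis2 ` carrier (Gamma 2)"
    unfolding carrier_stabilizer_Sp2
  proof (rule image_subsetI)
    fix m
    obtain A where "A \<in> carrier (Gamma 2)" "restr_matrix basis2 A = shear m" using shear_lifts by blast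
    then show "shear m \<in> restr_matrix basis2 ` carrier (Gamma 2)" by (metis image_eqI)
  qed
  then show "bij_betw (restr_matrix basis2) (carrier (Gamma 2)) (carrier (stabilizer Sp2 (unit_vec 2 0)))"
    unfolding bij_betw_def using inj_on_restr_basis2 hom_carrier[OF hom] by blast
qed

text \<open>
  The matrix that acts as \<open>M\<close> on the span of \<open>e\<^sub>1 + e\<^sub>2, e\<^sub>2 + e\<^sub>3\<close> and fixes \<open>v\<^sub>3\<close>.
\<close>

definition extend_fixing_v3 :: "int mat \<Rightarrow> int mat" where
  "extend_fixing_v3 M = (let a = M $$ (0, 0); b = M $$ (0, 1); c = M $$ (1, 0); d = M $$ (1, 1) in
     mat 3 3 (\<lambda>(i, j). [[1 - b, a + b - 1, 1 - a],
                        [1 - b - d, a + b + c + d - 1, 1 - a - c],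
                        [1 - d, c + d - 1, 1 - c]] ! i ! j))"

lemma extend_mat [simp]: "extend_fixing_v3 M \<in> carrier_mat 3 3"
  by (simp add: extend_fixing_v3_def Let_def)

text \<open>The columns arise from e_1 = v_3 - (e_2 + e_3), e_2 = (e_1 + e_2) + (e_2 + e_3) - v_3
  and e_3 = v_3 - (e_1 + e_2) by applying \<open>M\<close> on the plane and fixing v_3.\<close>

lemma extend_entries:
  "extend_fixing_v3 M $$ (0, 0) = 1 - M $$ (0, Suc 0)"
  "extend_fixing_v3 M $$ (0, Suc 0) = M $$ (0, 0) + M $$ (0, Suc 0) - 1"
  "extend_fixing_v3 M $$ (0, 2) = 1 - M $$ (0, 0)"
  "extend_fixing_v3 M $$ (Suc 0, 0) = 1 - M $$ (0, Suc 0) - M $$ (Suc 0, Suc 0)"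
  "extend_fixing_v3 M $$ (Suc 0, Suc 0)
    = M $$ (0, 0) + M $$ (0, Suc 0) + M $$ (Suc 0, 0) + M $$ (Suc 0, Suc 0) - 1"
  "extend_fixing_v3 M $$ (Suc 0, 2) = 1 - M $$ (0, 0) - M $$ (Suc 0, 0)"
  "extend_fixing_v3 M $$ (2, 0) = 1 - M $$ (Suc 0, Suc 0)"
  "extend_fixing_v3 M $$ (2, Suc 0) = M $$ (Suc 0, 0) + M $$ (Suc 0, Suc 0) - 1"
  "extend_fixing_v3 M $$ (2, 2) = 1 - M $$ (Suc 0, 0)"
  by (simp_all add: extend_fixing_v3_def Let_def)

lemma extend_mult:
  assumes "M \<in> carrier_mat 2 2" "N \<in> carrier_mat 2 2"
  shows "extend_fixing_v3 M * extend_fixing_v3 N = extend_fixing_v3 (M * N)"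
proof (rule eq_matI)
  fix i j assume "i < dim_row (extend_fixing_v3 (M * N))" "j < dim_col (extend_fixing_v3 (M * N))"
  then have "i < 3" "j < 3" using carrier_matD[OF extend_mat[of "M * N"]] by simp_all
  then show "(extend_fixing_v3 M * extend_fixing_v3 N) $$ (i, j) = extend_fixing_v3 (M * N) $$ (i, j)"
    using assms
    by (auto simp: mult_mat_index[OF extend_mat extend_mat] mult_mat_index[OF assms] sum_lessThan_3 sum_lessThan_2
        less_3_cases_iff extend_entries algebra_simps simp del: index_mult_mat(1) index_mult_mat_vec)
qed (use carrier_matD[OF extend_mat] in auto)

lemma extend_one: "extend_fixing_v3 (1\<^sub>m 2) = 1\<^sub>m 3"
  by (rule eq_matI) (auto simp: extend_entries less_3_cases_iff carrier_matD[OF extend_mat])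

lemma extend_Gamma:
  assumes "M \<in> carrier Sp2"
  shows "extend_fixing_v3 M \<in> carrier (Gamma 3)"
proof -
  let ?A = "extend_fixing_v3 M"
  have M: "M \<in> carrier (GL_int 2)" "det M = 1" using assms by (simp_all add: Sp2_iff)
  note Mm = GL_int_mat[OF M(1)]
  obtain N where N: "N \<in> carrier_mat 2 2" "N * M = 1\<^sub>m 2" "M * N = 1\<^sub>m 2" using M(1) by (auto simp: GL_int_iff)
  have "?A \<in> carrier (GL_int 3)"
    \<comment> \<open>Extension is multiplicative, so the inverse of \<open>M\<close> extends to the
      inverse of \<open>?A\<close>.\<close>
    using extend_mult[OF Mm N(1)] extend_mult[OF N(1) Mm] N extend_one
    by (auto simp: GL_int_iff intro!: bexI[of _ "extend_fixing_v3 N"])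
  moreover have "?A *\<^sub>v v_vec 3 = v_vec 3"
  proof (rule eq_vecI)
    fix i assume "i < dim_vec (v_vec 3)"
    then have i: "i < 3" by (simp add: v_vec_def)
    then show "(?A *\<^sub>v v_vec 3) $ i = v_vec 3 $ i"
      unfolding mult_mat_vec_index[OF extend_mat v_vec_carrier i]
      by (auto simp: sum_lessThan_3 less_3_cases_iff v_vec_def extend_entries)
  qed (use carrier_matD[OF extend_mat, of M] in \<open>simp add: v_vec_def\<close>)
  moreover have "transpose_mat ?A *\<^sub>v w_vec 3 = w_vec 3"
  proof (rule eq_vecI)
    fix i assume "i < dim_vec (w_vec 3)"
    then have i: "i < 3" by (simp add: w_vec_def)
    have At: "transpose_mat ?A \<in> carrier_mat 3 3" by simp
    show "(transpose_mat ?A *\<^sub>v w_vec 3) $ i = w_vec 3 $ i"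
      using i unfolding mult_mat_vec_index[OF At w_vec_carrier i]
      by (auto simp: sum_lessThan_3 less_3_cases_iff w_vec_def extend_entries carrier_matD[OF extend_mat])
  qed (use carrier_matD[OF extend_mat, of M] in \<open>simp add: w_vec_def\<close>)
  moreover have "form 3 (?A *\<^sub>v x) (?A *\<^sub>v y) = form 3 x y" if x: "x \<in> carrier_vec 3" and y: "y \<in> carrier_vec 3" for x y
  proof -
    define a b c d where abcd: "a = M $$ (0, 0)" "b = M $$ (0, 1)" "c = M $$ (1, 0)" "d = M $$ (1, 1)"
    have "a * d - b * c = 1" using M(2) det_two[OF Mm] by (simp add: abcd)
    \<comment> \<open>\<open>?A\<close> acts by \<open>M\<close> on the two differences occurring in
      \<open>form_3\<close>, hence it scales the form by det M = 1.\<close>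
    moreover have "(?A *\<^sub>v z) $ 1 - (?A *\<^sub>v z) $ 2 = a * (z $ 1 - z $ 2) + b * (z $ 1 - z $ 0)"
      "(?A *\<^sub>v z) $ 1 - (?A *\<^sub>v z) $ 0 = c * (z $ 1 - z $ 2) + d * (z $ 1 - z $ 0)"
      if z: "z \<in> carrier_vec 3" for z
      by (simp_all add: mult_mat_vec_index[OF extend_mat z] sum_lessThan_3 extend_entries abcd algebra_simps
          del: index_mult_mat_vec)
    moreover have "(a * p + b * q) * (c * p' + d * q') - (c * p + d * q) * (a * p' + b * q')
        = (a * d - b * c) * (p * q' - q * p')" for p q p' q'
      by (simp add: algebra_simps)
    ultimately show ?thesis unfolding form_3 by (simp add: x y)
  qed
  ultimately show ?thesis by (simp add: Gamma_def)
qed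

lemma restr_extend:
  assumes "M \<in> carrier_mat 2 2"
  shows "restr_matrix basis3 (extend_fixing_v3 M) = M"
proof (rule restr_matrix_eqI[OF basis3.U basis3.L basis3.LU extend_mat assms], rule eq_matI)
  fix i j assume "i < dim_row (basis3 * M)" "j < dim_col (basis3 * M)"
  then have "i < 3" "j < 2" using assms basis3_entries by auto
  then show "(extend_fixing_v3 M * basis3) $$ (i, j) = (basis3 * M) $$ (i, j)"
    by (auto simp: mult_mat_index[OF extend_mat basis3_entries(1)] mult_mat_index[OF basis3_entries(1) assms]
        sum_lessThan_3 sum_lessThan_2 basis3_entries less_3_cases_iff less_2_cases_iff extend_entries simp del: index_mult_mat(1) index_mult_mat_vec)
qed (use assms basis3_entries carrier_matD[OF extend_mat, of M] in auto)

lemma restr_basis3_iso: "restr_matrix basis3 \<in> iso (Gamma 3) Sp2"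
proof (rule isoI)
  show hom: "restr_matrix basis3 \<in> hom (Gamma 3) Sp2" by (rule basis3.restr_hom)
  have "M \<in> restr_matrix basis3 ` carrier (Gamma 3)" if "M \<in> carrier Sp2" for M
  proof (rule image_eqI)
    show "M = restr_matrix basis3 (extend_fixing_v3 M)"
      using restr_extend[OF GL_int_mat[of M 2]] that by (simp add: Sp2_iff)
  qed (rule extend_Gamma[OF that])
  then show "bij_betw (restr_matrix basis3) (carrier (Gamma 3)) (carrier Sp2)"
    unfolding bij_betw_def using inj_on_restr_basis3 hom_carrier[OF hom] by blast
qed

theorem corollaryC:
  fixes n :: nat
  shows
    "(n = 2 \<longrightarrow>
        restr_matrix basis2 \<in> iso (Gamma n) (stabilizer Sp2 (unit_vec 2 0)) \<and>
        restr_matrix basis2 ` burau n ` carrier (braid_group n) = carrier (stabilizer SL2 (unit_vec 2 0)) \<and>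
        stabilizer SL2 (unit_vec 2 0) = stabilizer Sp2 (unit_vec 2 0) \<and>
        stabilizer Sp2 (unit_vec 2 0) \<cong> integer_group \<and>
        burau n ` carrier (braid_group n) = carrier (Gamma n)) \<and>
     (n = 3 \<longrightarrow>
        restr_matrix basis3 \<in> iso (Gamma n) Sp2 \<and>
        restr_matrix basis3 ` burau n ` carrier (braid_group n) = carrier SL2 \<and>
        SL2 = Sp2 \<and>
        burau n ` carrier (braid_group n) = carrier (Gamma n)) \<and>
     (n \<ge> 4 \<longrightarrow>
        (\<exists>\<iota>. \<iota> \<in> mon (sym_group n) (Gamma n Mod Gamma_cong n 2) \<and>
             (\<forall>i < n - 1. \<iota> (Transposition.transpose (i + 1) (i + 2))
                 = Gamma_quot n 2 (burau n (artin_gen n i))) \<and>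
             \<iota> ` carrier (sym_group n) = Gamma_quot n 2 ` burau n ` carrier (braid_group n) \<and>
             burau n ` carrier (braid_group n)
               = {A \<in> carrier (Gamma n). Gamma_quot n 2 A \<in> \<iota> ` carrier (sym_group n)}))"
proof -
  have image: "h ` carrier G = carrier H" if "h \<in> iso G H" for h and G H :: "int mat monoid"
    using that by (simp add: iso_def bij_betw_def)
  show ?thesis
  proof (intro conjI impI)
    show "\<exists>\<iota>. \<iota> \<in> mon (sym_group n) (Gamma n Mod Gamma_cong n 2) \<and>
             (\<forall>i < n - 1. \<iota> (Transposition.transpose (i + 1) (i + 2))
                 = Gamma_quot n 2 (burau n (artin_gen n i))) \<and>
             \<iota> ` carrier (sym_group n) = Gamma_quot n 2 ` burau n ` carrier (braid_group n) \<and>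
             burau n ` carrier (braid_group n)
               = {A \<in> carrier (Gamma n). Gamma_quot n 2 A \<in> \<iota> ` carrier (sym_group n)}"
      by (intro exI[of _ "perm_coset n"] conjI perm_coset_mon burau_image_as_preimage)
  qed (simp_all only: SL2_eq_Sp2 restr_basis2_iso restr_basis3_iso stabilizer_Sp2_cong_integer_group
      burau_image_2 burau_image_3 image[OF restr_basis2_iso] image[OF restr_basis3_iso])
qed

end
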